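(* Let $M$ be a STCR lightlike submanifold of an indefinite Kähler manifold $\bar M$. Then the distribution $\tilde D$ is integrable if and only if, for all $X,Y\in\Gamma(\tilde D)$, $$A_{\bar JX}Y-A_{\bar JY}X\in\Gamma(\tilde D).$$
   Context: Indefinite Kähler manifold $(\bar M,\bar J,\bar g)$: a semi-Riemannian manifold of constant index $q$, $0<q<\dim\bar M$, with an almost complex structure $\bar J$ ($\bar J^2=-I$) satisfying $\bar g(\bar JX,\bar JY)=\bar g(X,Y)$ and $\bar\nabla\bar J=0$, where $\bar\nabla$ is the Levi-Civita connection of $\bar g$. Lightlike submanifold: a submanifold $M$ of dimension $m$ of $\bar M$ (of dimension $m+n$), with induced metric $g$, such that $Rad(TM)=TM\cap TM^\perp$ has constant rank $r$, $1\le r\le m$. One fixes non-degenerate complements: a screen distribution $S(TM)$ with $TM=S(TM)\perp Rad(TM)$ and a screen transversal bundle $S(TM^\perp)$ with $TM^\perp=S(TM^\perp)\perp Rad(TM)$. The lightlike transversal bundle $ltr(TM)$ is a rank $r$ complement of $Rad(TM)$ in the orthogonal complement of $S(TM)\perp S(TM^\perp)$ in $T\bar M|_M$, locally spanned by $N_1,\dots,N_r$ with $\bar g(\xi_i,N_j)=\delta_{ij}$, $\bar g(N_i,N_j)=0$ for a local basis $\{\xi_i\}$ of $Rad(TM)$. Put $tr(TM)=ltr(TM)\perp S(TM^\perp)$; then $T\bar M|_M=TM\oplus tr(TM)$. STCR (screen transversal Cauchy Riemann) lightlike submanifold: a real lightlike submanifold $M$ of $\bar M$ such that (A) there are subbundles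 $D_1,D_2$ of $Rad(TM)$ with $Rad(TM)=D_1\oplus D_2$, $\bar J(D_1)\subset S(TM)$, $\bar J(D_2)\subset S(TM^\perp)$; (B) there are subbundles $D_0,D'$ of $S(TM)$ with $S(TM)=\{\bar JD_1\oplus D'\}\perp D_0$, $\bar J(D_0)=D_0$, $\bar J(D')=L_1\perp S$, where $D_0$ is non-degenerate and $L_1$, $S$ are vector subbundles of $ltr(TM)$ and $S(TM^\perp)$ respectively. Moreover $ltr(TM)=L_1\oplus L_2$ with $\bar J(L_1)\subset S(TM)$, $\bar J(L_2)\subset S(TM^\perp)$, and $S(TM^\perp)=\{\bar J(D_2)\oplus\bar J(L_2)\}\perp S$. Then $TM=D\oplus\tilde D$, where $D=D_0\oplus D_1\oplus\bar JD_1$ is $\bar J$-invariant and $\tilde D=D_2\oplus\bar JL_1\oplus\bar JS$ satisfies $\bar J\tilde D\subset tr(TM)$. Weingarten formula (for $X\in\Gamma(TM)$, $V\in\Gamma(tr(TM))$): $\bar\nabla_XV=-A_VX+\nabla^t_XV$, with $A_VX\in\Gamma(TM)$ and $\nabla^t_XV\in\Gamma(tr(TM))$. *)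

theory Defs
  imports "HOL-Analysis.Analysis" "HOL-Library.Set_Algebras"
begin

section \<open>Smooth manifolds\<close>

text \<open>For an open set \<open>S\<close> of a Euclidean space, \<open>f\<close> is of class C^k on \<open>S\<close> iff its iterated directional
  derivatives up to order \<open>k\<close> exist as total derivatives and are continuous.\<close>

primrec Ck_on :: "nat \<Rightarrow> 'a::euclidean_space set \<Rightarrow> ('a \<Rightarrow> 'b::real_normed_vector) \<Rightarrow> bool" where
  "Ck_on 0 S f \<longleftrightarrow> continuous_on S f"
| "Ck_on (Suc k) S f \<longleftrightarrow> (\<forall>x\<in>S. f differentiable (at x)) \<and>
     (\<forall>v. Ck_on k S (\<lambda>x. frechet_derivative f (at x) v))"

definition smooth_on :: "'a::euclidean_space set \<Rightarrow> ('a \<Rightarrow> 'b::real_normed_vector) \<Rightarrow> bool" where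
  "smooth_on S f \<longleftrightarrow> (\<forall>k. Ck_on k S f)"

text \<open>A chart is a pair of its domain and its coordinate map (whose values outside the domain are
  irrelevant). The model space \<open>'e\<close> fixes the dimension \<open>DIM('e)\<close>. The atlas need not be maximal.\<close>

type_synonym ('a, 'e) chart = "'a set \<times> ('a \<Rightarrow> 'e)"

record ('a, 'e) manifold =
  mtop :: "'a topology"
  atlas :: "('a, 'e) chart set"

abbreviation points :: "('a, 'e) manifold \<Rightarrow> 'a set" where
  "points M \<equiv> topspace (mtop M)"

definition chart_inv :: "('a, 'e) chart \<Rightarrow> 'e \<Rightarrow> 'a" where
  "chart_inv c = inv_into (fst c) (snd c)"

locale smooth_manifold =
  fixes M :: "('a, 'e::euclidean_space) manifold"
  assumes hausdorff: "Hausdorff_space (mtop M)"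
    and second_countable: "second_countable (mtop M)"
    and chart_open: "c \<in> atlas M \<Longrightarrow> openin (mtop M) (fst c)"
    and chart_image_open: "c \<in> atlas M \<Longrightarrow> open (snd c ` fst c)"
    and chart_homeo: "c \<in> atlas M \<Longrightarrow>
      homeomorphic_map (subtopology (mtop M) (fst c)) (top_of_set (snd c ` fst c)) (snd c)"
    and charts_cover: "(\<Union>c\<in>atlas M. fst c) = points M"
    and charts_compatible: "\<lbrakk>c \<in> atlas M; b \<in> atlas M\<rbrakk> \<Longrightarrow>
      smooth_on (snd c ` (fst c \<inter> fst b)) (snd b \<circ> chart_inv c)"

text \<open>Tangent vectors. Every point \<open>p\<close> has a preferred chart \<open>chart_at M p\<close>, and a tangent vector at \<open>p\<close>
  is represented by its components in that chart; so the tangent space at each point is the vector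
  space \<open>'e\<close>. Since the preferred chart varies with \<open>p\<close> without any regularity, all differentiation is
  done on components in one fixed chart \<open>c\<close>, related to the representing vectors by the Jacobian of
  the change of charts: \<open>tan_coord M c p v\<close> are the components in \<open>c\<close> of the tangent vector \<open>v\<close> at \<open>p\<close>,
  and \<open>coord_field M c w\<close> is the vector field on the domain of \<open>c\<close> with constant components \<open>w\<close> in \<open>c\<close>.
  Both maps are the identity at \<open>p\<close> if \<open>c\<close> is \<open>chart_at M p\<close>.\<close>

definition chart_at :: "('a, 'e) manifold \<Rightarrow> 'a \<Rightarrow> ('a, 'e) chart" where
  "chart_at M p = (SOME c. c \<in> atlas M \<and> p \<in> fst c)"

definition tan_coord ::
    "('a, 'e::euclidean_space) manifold \<Rightarrow> ('a, 'e) chart \<Rightarrow> 'a \<Rightarrow> 'e \<Rightarrow> 'e" where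
  "tan_coord M c p v =
     frechet_derivative (snd c \<circ> chart_inv (chart_at M p)) (at (snd (chart_at M p) p)) v"

definition coord_field ::
    "('a, 'e::euclidean_space) manifold \<Rightarrow> ('a, 'e) chart \<Rightarrow> 'e \<Rightarrow> 'a \<Rightarrow> 'e" where
  "coord_field M c w p =
     frechet_derivative (snd (chart_at M p) \<circ> chart_inv c) (at (snd c p)) w"

definition smooth_fun_on ::
    "('a, 'e::euclidean_space) manifold \<Rightarrow> 'a set \<Rightarrow> ('a \<Rightarrow> real) \<Rightarrow> bool" where
  "smooth_fun_on M U h \<longleftrightarrow> (\<forall>c\<in>atlas M. smooth_on (snd c ` (fst c \<inter> U)) (h \<circ> chart_inv c))"

definition smooth_vf_on ::
    "('a, 'e::euclidean_space) manifold \<Rightarrow> 'a set \<Rightarrow> ('a \<Rightarrow> 'e) \<Rightarrow> bool" where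
  "smooth_vf_on M U X \<longleftrightarrow> (\<forall>c\<in>atlas M.
     smooth_on (snd c ` (fst c \<inter> U)) ((\<lambda>q. tan_coord M c q (X q)) \<circ> chart_inv c))"

text \<open>Derivative of a vector valued function \<open>h\<close> in the direction of a vector field \<open>X\<close>.\<close>

definition vf_deriv ::
    "('a, 'e::euclidean_space) manifold \<Rightarrow> ('a \<Rightarrow> 'e) \<Rightarrow> ('a \<Rightarrow> 'v::real_normed_vector) \<Rightarrow> 'a \<Rightarrow> 'v" where
  "vf_deriv M X h p =
     frechet_derivative (h \<circ> chart_inv (chart_at M p)) (at (snd (chart_at M p) p)) (X p)"

text \<open>The Lie bracket, by its component formula
  \<open>[X, Y]\<^sup>k = X\<^sup>i \<partial>\<^sub>i Y\<^sup>k - Y\<^sup>i \<partial>\<^sub>i X\<^sup>k\<close> in the chart at \<open>p\<close>.\<close>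

definition lie_bracket ::
    "('a, 'e::euclidean_space) manifold \<Rightarrow> ('a \<Rightarrow> 'e) \<Rightarrow> ('a \<Rightarrow> 'e) \<Rightarrow> 'a \<Rightarrow> 'e" where
  "lie_bracket M X Y p =
     vf_deriv M X (\<lambda>q. tan_coord M (chart_at M p) q (Y q)) p
     - vf_deriv M Y (\<lambda>q. tan_coord M (chart_at M p) q (X q)) p"

definition distribution_sections ::
    "('a, 'e::euclidean_space) manifold \<Rightarrow> ('a \<Rightarrow> 'e set) \<Rightarrow> ('a \<Rightarrow> 'e) set" where
  "distribution_sections M D = {X. smooth_vf_on M (points M) X \<and> (\<forall>p\<in>points M. X p \<in> D p)}"

text \<open>Integrability of a distribution is closedness of its sections under the Lie bracket, as in
  Spivak's "Comprehensive Introduction to Differential Geometry" and as is usual in the theory of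
  (lightlike) submanifolds; no reference is made to the existence of leaves.\<close>

definition integrable_distribution ::
    "('a, 'e::euclidean_space) manifold \<Rightarrow> ('a \<Rightarrow> 'e set) \<Rightarrow> bool" where
  "integrable_distribution M D \<longleftrightarrow>
     (\<forall>X\<in>distribution_sections M D. \<forall>Y\<in>distribution_sections M D.
        lie_bracket M X Y \<in> distribution_sections M D)"

section \<open>Indefinite Kaehler manifolds\<close>

definition nondegenerate_on :: "('e::real_vector \<Rightarrow> 'e \<Rightarrow> real) \<Rightarrow> 'e set \<Rightarrow> bool" where
  "nondegenerate_on B W \<longleftrightarrow> (\<forall>u\<in>W. (\<forall>v\<in>W. B u v = 0) \<longrightarrow> u = 0)"

text \<open>The largest dimension of a subspace on which the form is negative definite.\<close>

definition form_index :: "('e::euclidean_space \<Rightarrow> 'e \<Rightarrow> real) \<Rightarrow> nat" where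
  "form_index B = Max {dim W |W. subspace W \<and> (\<forall>w\<in>W. w \<noteq> 0 \<longrightarrow> B w w < 0)}"

locale semi_riemannian_manifold = smooth_manifold M
  for M :: "('a, 'e::euclidean_space) manifold" +
  fixes q :: nat and g :: "'a \<Rightarrow> 'e \<Rightarrow> 'e \<Rightarrow> real"
  assumes metric_bilinear: "p \<in> points M \<Longrightarrow> bilinear (g p)"
    and metric_symmetric: "p \<in> points M \<Longrightarrow> g p u v = g p v u"
    and metric_nondegenerate: "p \<in> points M \<Longrightarrow> nondegenerate_on (g p) UNIV"
    and metric_index: "p \<in> points M \<Longrightarrow> form_index (g p) = q"
    and metric_smooth: "c \<in> atlas M \<Longrightarrow>
      smooth_fun_on M (fst c) (\<lambda>p. g p (coord_field M c u p) (coord_field M c v p))"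

text \<open>An affine connection, acting on the vector fields defined on arbitrary open subsets \<open>U\<close>. Only
  the values of \<open>nabla X Y\<close> on \<open>U\<close> for \<open>X\<close>, \<open>Y\<close> smooth on \<open>U\<close> are meaningful, and by locality they
  depend only on the restrictions to \<open>U\<close>.\<close>

locale affine_connection = smooth_manifold M
  for M :: "('a, 'e::euclidean_space) manifold" +
  fixes nabla :: "('a \<Rightarrow> 'e) \<Rightarrow> ('a \<Rightarrow> 'e) \<Rightarrow> 'a \<Rightarrow> 'e"
  assumes connection_smooth:
      "\<lbrakk>openin (mtop M) U; smooth_vf_on M U X; smooth_vf_on M U Y\<rbrakk> \<Longrightarrow> smooth_vf_on M U (nabla X Y)"
    and connection_local:
      "\<lbrakk>openin (mtop M) U; smooth_vf_on M U X; smooth_vf_on M U Y;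
        \<And>x. x \<in> U \<Longrightarrow> X' x = X x; \<And>x. x \<in> U \<Longrightarrow> Y' x = Y x; p \<in> U\<rbrakk> \<Longrightarrow> nabla X' Y' p = nabla X Y p"
    and connection_add_left:
      "\<lbrakk>openin (mtop M) U; smooth_vf_on M U X; smooth_vf_on M U X'; smooth_vf_on M U Y; p \<in> U\<rbrakk> \<Longrightarrow>
        nabla (\<lambda>x. X x + X' x) Y p = nabla X Y p + nabla X' Y p"
    and connection_scale_left:
      "\<lbrakk>openin (mtop M) U; smooth_fun_on M U h; smooth_vf_on M U X; smooth_vf_on M U Y; p \<in> U\<rbrakk> \<Longrightarrow>
        nabla (\<lambda>x. h x *\<^sub>R X x) Y p = h p *\<^sub>R nabla X Y p"
    and connection_add_right:
      "\<lbrakk>openin (mtop M) U; smooth_vf_on M U X; smooth_vf_on M U Y; smooth_vf_on M U Y'; p \<in> U\<rbrakk> \<Longrightarrow>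
        nabla X (\<lambda>x. Y x + Y' x) p = nabla X Y p + nabla X Y' p"
    and connection_leibniz:
      "\<lbrakk>openin (mtop M) U; smooth_fun_on M U h; smooth_vf_on M U X; smooth_vf_on M U Y; p \<in> U\<rbrakk> \<Longrightarrow>
        nabla X (\<lambda>x. h x *\<^sub>R Y x) p = vf_deriv M X h p *\<^sub>R Y p + h p *\<^sub>R nabla X Y p"

locale levi_civita_connection =
  semi_riemannian_manifold M q g + affine_connection M nabla
  for M :: "('a, 'e::euclidean_space) manifold" and q g nabla +
  assumes torsion_free:
      "\<lbrakk>openin (mtop M) U; smooth_vf_on M U X; smooth_vf_on M U Y; p \<in> U\<rbrakk> \<Longrightarrow>
        nabla X Y p - nabla Y X p = lie_bracket M X Y p"
    and metric_compatible:
      "\<lbrakk>openin (mtop M) U; smooth_vf_on M U X; smooth_vf_on M U Y; smooth_vf_on M U Z; p \<in> U\<rbrakk> \<Longrightarrow>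
        vf_deriv M X (\<lambda>x. g x (Y x) (Z x)) p = g p (nabla X Y p) (Z p) + g p (Y p) (nabla X Z p)"

locale indefinite_kaehler_manifold = levi_civita_connection M q g nabla
  for M :: "('a, 'e::euclidean_space) manifold" and q g nabla +
  fixes J :: "'a \<Rightarrow> 'e \<Rightarrow> 'e"
  assumes index_bounds: "0 < q" "q < DIM('e)"
    and J_linear: "p \<in> points M \<Longrightarrow> linear (J p)"
    and J_smooth: "c \<in> atlas M \<Longrightarrow> smooth_vf_on M (fst c) (\<lambda>p. J p (coord_field M c w p))"
    and J_square: "p \<in> points M \<Longrightarrow> J p (J p v) = - v"
    and J_isometric: "p \<in> points M \<Longrightarrow> g p (J p u) (J p v) = g p u v"
    and J_parallel:
      "\<lbrakk>openin (mtop M) U; smooth_vf_on M U X; smooth_vf_on M U Y; p \<in> U\<rbrakk> \<Longrightarrow>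
        nabla X (\<lambda>x. J x (Y x)) p = J p (nabla X Y p)"

section \<open>Submanifolds and bundles along them\<close>

text \<open>A submanifold of \<open>Mb\<close> is a manifold \<open>M\<close> with an immersion \<open>f\<close> into \<open>Mb\<close> (the inclusion, for a
  submanifold given as a subset). Vector bundles over \<open>M\<close> are subbundles of the pullback along \<open>f\<close>
  of the tangent bundle of \<open>Mb\<close>: their fibre at \<open>p\<close> is a subspace of the tangent space of \<open>Mb\<close> at
  \<open>f p\<close>. In particular the tangent space of \<open>M\<close> appears there as the range of the differential.\<close>

definition differential ::
    "('a, 'e::euclidean_space) manifold \<Rightarrow> ('b, 'd::euclidean_space) manifold \<Rightarrow> ('b \<Rightarrow> 'a) \<Rightarrow> 'b \<Rightarrow> 'd \<Rightarrow> 'e"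
  where "differential Mb M f p v =
    frechet_derivative (snd (chart_at Mb (f p)) \<circ> f \<circ> chart_inv (chart_at M p))
      (at (snd (chart_at M p) p)) v"

locale immersed_submanifold = Mb: smooth_manifold Mb + M: smooth_manifold M
  for Mb :: "('a, 'e::euclidean_space) manifold" and M :: "('b, 'd::euclidean_space) manifold" +
  fixes f :: "'b \<Rightarrow> 'a"
  assumes immersion_continuous: "continuous_map (mtop M) (mtop Mb) f"
    and immersion_smooth: "\<lbrakk>c \<in> atlas M; b \<in> atlas Mb\<rbrakk> \<Longrightarrow>
      smooth_on (snd c ` (fst c \<inter> f -` fst b)) (snd b \<circ> f \<circ> chart_inv c)"
    and immersion_inj: "p \<in> points M \<Longrightarrow> inj (differential Mb M f p)"

definition smooth_along_on ::
    "('a, 'e::euclidean_space) manifold \<Rightarrow> ('b, 'd::euclidean_space) manifold \<Rightarrow> ('b \<Rightarrow> 'a) \<Rightarrow>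
     'b set \<Rightarrow> ('b \<Rightarrow> 'e) \<Rightarrow> bool" where
  "smooth_along_on Mb M f U V \<longleftrightarrow> (\<forall>c\<in>atlas M. \<forall>b\<in>atlas Mb.
     smooth_on (snd c ` (fst c \<inter> U \<inter> f -` fst b)) ((\<lambda>x. tan_coord Mb b (f x) (V x)) \<circ> chart_inv c))"

definition smooth_frame ::
    "('a, 'e::euclidean_space) manifold \<Rightarrow> ('b, 'd::euclidean_space) manifold \<Rightarrow> ('b \<Rightarrow> 'a) \<Rightarrow>
     'b set \<Rightarrow> nat \<Rightarrow> (nat \<Rightarrow> 'b \<Rightarrow> 'e) \<Rightarrow> ('b \<Rightarrow> 'e set) \<Rightarrow> bool" where
  "smooth_frame Mb M f U k s E \<longleftrightarrow> (\<forall>i<k. smooth_along_on Mb M f U (s i)) \<and>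
     (\<forall>x\<in>U. E x = span ((\<lambda>i. s i x) ` {..<k}) \<and> dim (E x) = k)"

text \<open>The rank of a subbundle is only required to be locally constant.\<close>

definition subbundle ::
    "('a, 'e::euclidean_space) manifold \<Rightarrow> ('b, 'd::euclidean_space) manifold \<Rightarrow> ('b \<Rightarrow> 'a) \<Rightarrow>
     ('b \<Rightarrow> 'e set) \<Rightarrow> bool" where
  "subbundle Mb M f E \<longleftrightarrow>
     (\<forall>p\<in>points M. \<exists>U k s. openin (mtop M) U \<and> p \<in> U \<and> smooth_frame Mb M f U k s E)"

text \<open>The covariant derivative along \<open>f\<close> of a section \<open>V\<close> of the pullback bundle with respect to a
  vector field \<open>X\<close> on \<open>M\<close>. In the chart at \<open>f p\<close>, write \<open>V = V\<^sup>k (\<partial>\<^sub>k \<circ> f)\<close>; then the value at \<open>p\<close> is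
  \<open>X(V\<^sup>k) \<partial>\<^sub>k + V\<^sup>k nabla\<^bsub>df X\<^esub> \<partial>\<^sub>k\<close>. The second summand is computed with the local extensions of
  \<open>df (X p)\<close> and \<open>V p\<close> that have constant components.\<close>

definition cov_along ::
    "('a, 'e::euclidean_space) manifold \<Rightarrow> (('a \<Rightarrow> 'e) \<Rightarrow> ('a \<Rightarrow> 'e) \<Rightarrow> 'a \<Rightarrow> 'e) \<Rightarrow>
     ('b, 'd::euclidean_space) manifold \<Rightarrow> ('b \<Rightarrow> 'a) \<Rightarrow> ('b \<Rightarrow> 'd) \<Rightarrow> ('b \<Rightarrow> 'e) \<Rightarrow> 'b \<Rightarrow> 'e" where
  "cov_along Mb nabla M f X V p = (let b = chart_at Mb (f p) in
     vf_deriv M X (\<lambda>x. tan_coord Mb b (f x) (V x)) p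
     + nabla (coord_field Mb b (differential Mb M f p (X p))) (coord_field Mb b (V p)) (f p))"

section \<open>Lightlike submanifolds\<close>

definition orth :: "('e \<Rightarrow> 'e \<Rightarrow> real) \<Rightarrow> 'e set \<Rightarrow> 'e set" where
  "orth B W = {v. \<forall>w\<in>W. B v w = 0}"

text \<open>For subspaces, \<open>U + V\<close> below is the elementwise sum of sets.\<close>

definition direct_sum :: "'e::real_vector set \<Rightarrow> 'e set \<Rightarrow> 'e set \<Rightarrow> bool" where
  "direct_sum W U V \<longleftrightarrow> W = U + V \<and> U \<inter> V = {0}"

definition orth_direct_sum ::
    "('e::real_vector \<Rightarrow> 'e \<Rightarrow> real) \<Rightarrow> 'e set \<Rightarrow> 'e set \<Rightarrow> 'e set \<Rightarrow> bool" where
  "orth_direct_sum B W U V \<longleftrightarrow> direct_sum W U V \<and> (\<forall>u\<in>U. \<forall>v\<in>V. B u v = 0)"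

definition tangent_bundle ::
    "('a, 'e::euclidean_space) manifold \<Rightarrow> ('b, 'd::euclidean_space) manifold \<Rightarrow> ('b \<Rightarrow> 'a) \<Rightarrow> 'b \<Rightarrow> 'e set"
  where "tangent_bundle Mb M f p = range (differential Mb M f p)"

definition normal_bundle ::
    "('a, 'e::euclidean_space) manifold \<Rightarrow> ('a \<Rightarrow> 'e \<Rightarrow> 'e \<Rightarrow> real) \<Rightarrow>
     ('b, 'd::euclidean_space) manifold \<Rightarrow> ('b \<Rightarrow> 'a) \<Rightarrow> 'b \<Rightarrow> 'e set" where
  "normal_bundle Mb g M f p = orth (g (f p)) (tangent_bundle Mb M f p)"

definition radical ::
    "('a, 'e::euclidean_space) manifold \<Rightarrow> ('a \<Rightarrow> 'e \<Rightarrow> 'e \<Rightarrow> real) \<Rightarrow>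
     ('b, 'd::euclidean_space) manifold \<Rightarrow> ('b \<Rightarrow> 'a) \<Rightarrow> 'b \<Rightarrow> 'e set" where
  "radical Mb g M f p = tangent_bundle Mb M f p \<inter> normal_bundle Mb g M f p"

text \<open>\<open>STM\<close> is the screen distribution, \<open>STMperp\<close> the screen transversal bundle and \<open>ltr\<close> the lightlike
  transversal bundle.\<close>

locale lightlike_submanifold =
  semi_riemannian_manifold Mb q g + immersed_submanifold Mb M f
  for Mb :: "('a, 'e::euclidean_space) manifold" and q g
    and M :: "('b, 'd::euclidean_space) manifold" and f +
  fixes r :: nat and STM STMperp ltr :: "'b \<Rightarrow> 'e set"
  assumes rank_bounds: "1 \<le> r" "r \<le> DIM('d)"
    and radical_rank: "p \<in> points M \<Longrightarrow> dim (radical Mb g M f p) = r"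
    and screen_subbundle: "subbundle Mb M f STM"
    and screen_sum: "p \<in> points M \<Longrightarrow>
      orth_direct_sum (g (f p)) (tangent_bundle Mb M f p) (STM p) (radical Mb g M f p)"
    and screen_nondegenerate: "p \<in> points M \<Longrightarrow> nondegenerate_on (g (f p)) (STM p)"
    and screen_transversal_subbundle: "subbundle Mb M f STMperp"
    and screen_transversal_sum: "p \<in> points M \<Longrightarrow>
      orth_direct_sum (g (f p)) (normal_bundle Mb g M f p) (STMperp p) (radical Mb g M f p)"
    and screen_transversal_nondegenerate: "p \<in> points M \<Longrightarrow> nondegenerate_on (g (f p)) (STMperp p)"
    and ltr_subbundle: "subbundle Mb M f ltr"
    and ltr_complement: "p \<in> points M \<Longrightarrow>
      direct_sum (orth (g (f p)) (STM p + STMperp p)) (radical Mb g M f p) (ltr p)"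
    and ltr_frame: "p \<in> points M \<Longrightarrow>
      \<exists>U \<xi> N. openin (mtop M) U \<and> p \<in> U \<and>
        smooth_frame Mb M f U r \<xi> (radical Mb g M f) \<and> smooth_frame Mb M f U r N ltr \<and>
        (\<forall>x\<in>U. \<forall>i<r. \<forall>j<r. g (f x) (\<xi> i x) (N j x) = (if i = j then 1 else 0) \<and>
                              g (f x) (N i x) (N j x) = 0)"

definition transversal_bundle :: "('b \<Rightarrow> 'e::real_vector set) \<Rightarrow> ('b \<Rightarrow> 'e set) \<Rightarrow> 'b \<Rightarrow> 'e set" where
  "transversal_bundle ltr STMperp p = ltr p + STMperp p"

text \<open>The operator \<open>A\<^sub>V X\<close> of the Weingarten formula: the tangential vector field, with respect to
  the splitting into \<open>TM\<close> and \<open>tr(TM)\<close>, such that \<open>nabla\<^sub>X V + df (A\<^sub>V X)\<close> lies in \<open>tr(TM)\<close>.\<close>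

definition shape_operator ::
    "('a, 'e::euclidean_space) manifold \<Rightarrow> (('a \<Rightarrow> 'e) \<Rightarrow> ('a \<Rightarrow> 'e) \<Rightarrow> 'a \<Rightarrow> 'e) \<Rightarrow>
     ('b, 'd::euclidean_space) manifold \<Rightarrow> ('b \<Rightarrow> 'a) \<Rightarrow> ('b \<Rightarrow> 'e set) \<Rightarrow>
     ('b \<Rightarrow> 'e) \<Rightarrow> ('b \<Rightarrow> 'd) \<Rightarrow> 'b \<Rightarrow> 'd" where
  "shape_operator Mb nabla M f tr V X p =
     (THE w. cov_along Mb nabla M f X V p + differential Mb M f p w \<in> tr p)"

section \<open>STCR lightlike submanifolds\<close>

locale STCR_lightlike_submanifold =
  indefinite_kaehler_manifold Mb q g nabla J +
  lightlike_submanifold Mb q g M f r STM STMperp ltr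
  for Mb :: "('a, 'e::euclidean_space) manifold" and q g nabla J
    and M :: "('b, 'd::euclidean_space) manifold" and f r STM STMperp ltr +
  fixes D1 D2 D0 D' L1 L2 S :: "'b \<Rightarrow> 'e set"
  assumes subbundles: "subbundle Mb M f D1" "subbundle Mb M f D2" "subbundle Mb M f D0"
      "subbundle Mb M f D'" "subbundle Mb M f L1" "subbundle Mb M f L2" "subbundle Mb M f S"
    and radical_sum: "p \<in> points M \<Longrightarrow> direct_sum (radical Mb g M f p) (D1 p) (D2 p)"
    and J_D1: "p \<in> points M \<Longrightarrow> J (f p) ` D1 p \<subseteq> STM p"
    and J_D2: "p \<in> points M \<Longrightarrow> J (f p) ` D2 p \<subseteq> STMperp p"
    and J_D1_D'_direct: "p \<in> points M \<Longrightarrow> J (f p) ` D1 p \<inter> D' p = {0}"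
    and screen_decomposition: "p \<in> points M \<Longrightarrow>
      orth_direct_sum (g (f p)) (STM p) (J (f p) ` D1 p + D' p) (D0 p)"
    and J_D0: "p \<in> points M \<Longrightarrow> J (f p) ` D0 p = D0 p"
    and J_D': "p \<in> points M \<Longrightarrow> orth_direct_sum (g (f p)) (J (f p) ` D' p) (L1 p) (S p)"
    and D0_nondegenerate: "p \<in> points M \<Longrightarrow> nondegenerate_on (g (f p)) (D0 p)"
    and ltr_sum: "p \<in> points M \<Longrightarrow> direct_sum (ltr p) (L1 p) (L2 p)"
    and J_L1: "p \<in> points M \<Longrightarrow> J (f p) ` L1 p \<subseteq> STM p"
    and J_L2: "p \<in> points M \<Longrightarrow> J (f p) ` L2 p \<subseteq> STMperp p"
    and J_D2_J_L2_direct: "p \<in> points M \<Longrightarrow> J (f p) ` D2 p \<inter> J (f p) ` L2 p = {0}"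
    and screen_transversal_decomposition: "p \<in> points M \<Longrightarrow>
      orth_direct_sum (g (f p)) (STMperp p) (J (f p) ` D2 p + J (f p) ` L2 p) (S p)"

text \<open>The bundle \<open>D2 \<oplus> J L1 \<oplus> J S\<close>, viewed as a distribution on \<open>M\<close> via the differential of \<open>f\<close>.\<close>

definition D_tilde ::
    "('a, 'e::euclidean_space) manifold \<Rightarrow> ('a \<Rightarrow> 'e \<Rightarrow> 'e) \<Rightarrow> ('b, 'd::euclidean_space) manifold \<Rightarrow>
     ('b \<Rightarrow> 'a) \<Rightarrow> ('b \<Rightarrow> 'e set) \<Rightarrow> ('b \<Rightarrow> 'e set) \<Rightarrow> ('b \<Rightarrow> 'e set) \<Rightarrow> 'b \<Rightarrow> 'd set" where
  "D_tilde Mb J M f D2 L1 S p =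
     {v. differential Mb M f p v \<in> D2 p + J (f p) ` L1 p + J (f p) ` S p}"

text \<open>\<open>J X\<close>, for a vector field \<open>X\<close> on \<open>M\<close>.\<close>

definition J_along ::
    "('a, 'e::euclidean_space) manifold \<Rightarrow> ('a \<Rightarrow> 'e \<Rightarrow> 'e) \<Rightarrow> ('b, 'd::euclidean_space) manifold \<Rightarrow>
     ('b \<Rightarrow> 'a) \<Rightarrow> ('b \<Rightarrow> 'd) \<Rightarrow> 'b \<Rightarrow> 'e" where
  "J_along Mb J M f X p = J (f p) (differential Mb M f p (X p))"

end

theory Submission
  imports Defs
begin

text \<open>Torsion-freeness and parallelism of \<open>J\<close> carry over to the covariant derivative along the
  immersion \<open>f\<close>. Hence for sections \<open>X\<close>, \<open>Y\<close> of \<open>D~\<close>, whose images under \<open>J\<close> are transversal, the Weingarten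
  formula gives \<open>J [X, Y] = W + (a transversal field)\<close> with \<open>W = A (J X) Y - A (J Y) X\<close>.
  If \<open>[X, Y]\<close> lies in \<open>D~\<close>, then \<open>J [X, Y]\<close> is transversal, so \<open>W = 0\<close>. Conversely, decompose
  \<open>[X, Y] = P + Q\<close> with \<open>P\<close> in \<open>D\<close> and \<open>Q\<close> in \<open>D~\<close>: the tangential part of \<open>J [X, Y]\<close> is \<open>W = J P\<close>,
  which lies in \<open>D\<close>; if \<open>W\<close> is also in \<open>D~\<close>, it vanishes, and so does \<open>P\<close>.\<close>

section \<open>Calculus of smooth maps\<close>

text \<open>The argument at a single point is short; the analysis behind it is not. Tangent vectors
  are stored in a preferred chart that varies with the point without any regularity, and
  \<open>lie_bracket\<close>, \<open>differential\<close> and \<open>cov_along\<close> are formulas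
  at one point. To be differentiated, the first two must be rewritten in fixed charts, and each
  rewriting is a chain rule through a transition map. Fields along \<open>f\<close> are not extended
  to the ambient manifold; the identities for \<open>cov_along\<close> are derived from its
  coordinate formula. One fact serves both the chart independence of the bracket and
  torsion-freeness along \<open>f\<close>: a smooth map pushes brackets forward, because its second
  derivative is symmetric. Smoothness is part of membership in \<open>distribution_sections\<close>.
  The bracket is smooth by its formula in a fixed chart. The field \<open>W\<close> is defined
  pointwise through \<open>THE\<close>, and its smoothness is not studied in general: if the bracket
  lies in the distribution, then \<open>W\<close> is zero, and the converse uses \<open>W\<close>
  only point by point.\<close>

lemma has_derivative_frechet:
  "f differentiable (at x) \<Longrightarrow> (f has_derivative frechet_derivative f (at x)) (at x)"
  by (simp add: frechet_derivative_works)

lemma frechet_derivative_eqI: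
  "(f has_derivative D) (at x) \<Longrightarrow> frechet_derivative f (at x) v = D v"
  by (simp add: frechet_derivative_at[symmetric])

lemma frechet_derivative_cong_open:
  assumes "open S" "x \<in> S" "\<And>y. y \<in> S \<Longrightarrow> f y = g y"
  shows "frechet_derivative f (at x) = frechet_derivative g (at x)"
proof -
  have "(f has_derivative D) (at x) \<longleftrightarrow> (g has_derivative D) (at x)" for D
    by (metis assms has_derivative_transform_within_open)
  then show ?thesis by (simp add: frechet_derivative_def)
qed

lemma differentiable_cong_open:
  assumes "open S" "x \<in> S" "\<And>y. y \<in> S \<Longrightarrow> f y = g y" "g differentiable (at x)"
  shows "f differentiable (at x)"
  using assms unfolding differentiable_def by (metis has_derivative_transform_within_open)

section \<open>Closure properties of C^k maps\<close>

lemma Ck_on_cong: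
  assumes "open S" "\<And>x. x \<in> S \<Longrightarrow> f x = g x"
  shows "Ck_on k S f \<longleftrightarrow> Ck_on k S g"
  using assms(2)
proof (induction k arbitrary: f g)
  case 0
  then show ?case by (simp cong: continuous_on_cong)
next
  case (Suc k)
  have "f differentiable (at x) \<longleftrightarrow> g differentiable (at x)" if "x \<in> S" for x
    using differentiable_cong_open[OF assms(1) that] Suc.prems by metis
  moreover have "Ck_on k S (\<lambda>x. frechet_derivative f (at x) v) \<longleftrightarrow>
      Ck_on k S (\<lambda>x. frechet_derivative g (at x) v)" for v
    by (rule Suc.IH) (metis frechet_derivative_cong_open[OF assms(1)] Suc.prems)
  ultimately show ?case by simp
qed

lemma Ck_on_subset: "Ck_on k S f \<Longrightarrow> T \<subseteq> S \<Longrightarrow> Ck_on k T f"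
  by (induction k arbitrary: f) (auto intro: continuous_on_subset)

text \<open>\<open>Ck_on (Suc k)\<close> does not contain \<open>Ck_on k\<close> by definition; at
  the bottom, differentiability yields continuity. Product and chain rules leave undifferentiated
  factors, which have to be available at the lower order.\<close>

lemma Ck_on_Suc_imp:
  assumes "Ck_on (Suc k) S f"
  shows "Ck_on k S f"
  using assms
proof (induction k arbitrary: f)
  case 0
  then show ?case
    by (simp add: continuous_at_imp_continuous_on differentiable_imp_continuous_within)
next
  case (Suc k)
  then show ?case by (metis Ck_on.simps(2))
qed

lemma Ck_on_const: "Ck_on k S (\<lambda>x. c)"
  by (induction k arbitrary: c) simp_all

lemma Ck_on_add:
  assumes "open S" "Ck_on k S f" "Ck_on k S g"
  shows "Ck_on k S (\<lambda>x. f x + g x)"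
  using assms(2,3)
proof (induction k arbitrary: f g)
  case 0
  then show ?case by (simp add: continuous_on_add)
next
  case (Suc k)
  have "Ck_on k S (\<lambda>x. frechet_derivative (\<lambda>x. f x + g x) (at x) v) \<longleftrightarrow>
      Ck_on k S (\<lambda>x. frechet_derivative f (at x) v + frechet_derivative g (at x) v)" for v
  proof (rule Ck_on_cong[OF assms(1)])
    fix x assume "x \<in> S"
    then have "((\<lambda>x. f x + g x) has_derivative
        (\<lambda>v. frechet_derivative f (at x) v + frechet_derivative g (at x) v)) (at x)"
      using Suc.prems by (intro derivative_intros has_derivative_frechet) auto
    then show "frechet_derivative (\<lambda>x. f x + g x) (at x) v =
        frechet_derivative f (at x) v + frechet_derivative g (at x) v"
      by (rule frechet_derivative_eqI)
  qed
  then show ?case using Suc by simp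
qed

lemma Ck_on_scaleR:
  assumes "open S" "Ck_on k S f" "Ck_on k S g"
  shows "Ck_on k S (\<lambda>x. f x *\<^sub>R g x)"
  using assms(2,3)
proof (induction k arbitrary: f g)
  case 0
  then show ?case by (simp add: continuous_on_scaleR)
next
  case (Suc k)
  have "Ck_on k S (\<lambda>x. frechet_derivative (\<lambda>x. f x *\<^sub>R g x) (at x) v) \<longleftrightarrow>
      Ck_on k S (\<lambda>x. f x *\<^sub>R frechet_derivative g (at x) v + frechet_derivative f (at x) v *\<^sub>R g x)" for v
  proof (rule Ck_on_cong[OF assms(1)])
    fix x assume "x \<in> S"
    then have "((\<lambda>x. f x *\<^sub>R g x) has_derivative
        (\<lambda>v. f x *\<^sub>R frechet_derivative g (at x) v + frechet_derivative f (at x) v *\<^sub>R g x)) (at x)"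
      using Suc.prems by (intro derivative_intros has_derivative_frechet) auto
    then show "frechet_derivative (\<lambda>x. f x *\<^sub>R g x) (at x) v =
        f x *\<^sub>R frechet_derivative g (at x) v + frechet_derivative f (at x) v *\<^sub>R g x"
      by (rule frechet_derivative_eqI)
  qed
  moreover have "Ck_on k S f" "Ck_on k S g"
    using Suc.prems Ck_on_Suc_imp by auto
  ultimately show ?case using Suc by (auto intro!: Ck_on_add[OF assms(1)])
qed

lemma Ck_on_bounded_linear:
  assumes "open S" "bounded_linear L" "Ck_on k S f"
  shows "Ck_on k S (\<lambda>x. L (f x))"
  using assms(3)
proof (induction k arbitrary: f)
  case 0
  then show ?case using bounded_linear.continuous_on[OF assms(2)] by simp
next
  case (Suc k)
  have "((\<lambda>x. L (f x)) has_derivative (\<lambda>v. L (frechet_derivative f (at x) v))) (at x)" if "x \<in> S" for x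
    using that Suc.prems by (intro bounded_linear.has_derivative[OF assms(2)] has_derivative_frechet) auto
  then have "frechet_derivative (\<lambda>x. L (f x)) (at x) = (\<lambda>v. L (frechet_derivative f (at x) v))"
    and "(\<lambda>x. L (f x)) differentiable at x" if "x \<in> S" for x
    using that by (auto simp: frechet_derivative_at[symmetric] differentiable_def)
  then show ?case using Suc by (simp cong: Ck_on_cong[OF assms(1)])
qed

lemma Ck_on_sum:
  assumes "open S" "\<And>i. i \<in> A \<Longrightarrow> Ck_on k S (f i)"
  shows "Ck_on k S (\<lambda>x. \<Sum>i\<in>A. f i x)"
  using assms(2)
  by (induction A rule: infinite_finite_induct)
     (simp_all add: Ck_on_const Ck_on_add[OF assms(1)])

lemma linear_euclidean_expand:
  fixes L :: "'a::euclidean_space \<Rightarrow> 'b::real_normed_vector"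
  assumes "linear L"
  shows "L v = (\<Sum>i\<in>Basis. (v \<bullet> i) *\<^sub>R L i)"
proof -
  have "L v = L (\<Sum>i\<in>Basis. (v \<bullet> i) *\<^sub>R i)" by (simp add: euclidean_representation)
  also have "\<dots> = (\<Sum>i\<in>Basis. (v \<bullet> i) *\<^sub>R L i)"
    using assms by (simp add: linear_sum linear_scale)
  finally show ?thesis .
qed

lemma linear_frechet_derivative: "f differentiable (at x) \<Longrightarrow> linear (frechet_derivative f (at x))"
  by (intro bounded_linear.linear has_derivative_bounded_linear[OF has_derivative_frechet])

lemma frechet_derivative_chain:
  assumes "g differentiable (at x)" "f differentiable (at (g x))"
  shows "frechet_derivative (\<lambda>x. f (g x)) (at x) v =
      frechet_derivative f (at (g x)) (frechet_derivative g (at x) v)"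
    and "(\<lambda>x. f (g x)) differentiable (at x)"
proof -
  have "((\<lambda>x. f (g x)) has_derivative
      (\<lambda>v. frechet_derivative f (at (g x)) (frechet_derivative g (at x) v))) (at x)"
    by (rule has_derivative_compose[OF has_derivative_frechet[OF assms(1)] has_derivative_frechet[OF assms(2)]])
  then show "frechet_derivative (\<lambda>x. f (g x)) (at x) v =
      frechet_derivative f (at (g x)) (frechet_derivative g (at x) v)"
    and "(\<lambda>x. f (g x)) differentiable (at x)"
    by (rule frechet_derivative_eqI, auto simp: differentiable_def)
qed

text \<open>\<open>Ck_on\<close> controls derivatives in constant directions only, while the chain
  rule differentiates \<open>f\<close> in the moving direction \<open>Dg(x) v\<close>. Expanding
  that direction in \<open>Basis\<close> leaves products of components of \<open>Dg\<close> with
  derivatives of \<open>f\<close> in fixed directions, to which the induction hypothesis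
  applies.\<close>

lemma Ck_on_compose:
  fixes g :: "'a::euclidean_space \<Rightarrow> 'b::euclidean_space" and f :: "'b \<Rightarrow> 'c::real_normed_vector"
  assumes "open S" "g ` S \<subseteq> T" "Ck_on k S g" "Ck_on k T f"
  shows "Ck_on k S (\<lambda>x. f (g x))"
  using assms(3,4)
proof (induction k arbitrary: f)
  case 0
  then show ?case using assms(2) by (auto intro: continuous_on_compose2)
next
  case (Suc k)
  have g: "g differentiable (at x)" and f: "f differentiable (at (g x))" if "x \<in> S" for x
    using that Suc.prems assms(2) by auto
  have "Ck_on k S (\<lambda>x. frechet_derivative (\<lambda>x. f (g x)) (at x) v) \<longleftrightarrow>
      Ck_on k S (\<lambda>x. \<Sum>i\<in>Basis. (frechet_derivative g (at x) v \<bullet> i) *\<^sub>R frechet_derivative f (at (g x)) i)" for v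
  proof (rule Ck_on_cong[OF assms(1)])
    fix x assume "x \<in> S"
    then show "frechet_derivative (\<lambda>x. f (g x)) (at x) v =
        (\<Sum>i\<in>Basis. (frechet_derivative g (at x) v \<bullet> i) *\<^sub>R frechet_derivative f (at (g x)) i)"
      using frechet_derivative_chain(1)[OF g f] linear_euclidean_expand[OF linear_frechet_derivative[OF f]]
      by auto
  qed
  moreover have "Ck_on k S (\<lambda>x. \<Sum>i\<in>Basis. (frechet_derivative g (at x) v \<bullet> i) *\<^sub>R
      frechet_derivative f (at (g x)) i)" for v
  proof (intro Ck_on_sum Ck_on_scaleR assms(1))
    fix i :: 'b
    show "Ck_on k S (\<lambda>x. frechet_derivative g (at x) v \<bullet> i)"
      using Suc.prems by (intro Ck_on_bounded_linear[OF assms(1) bounded_linear_inner_left]) auto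
    show "Ck_on k S (\<lambda>x. frechet_derivative f (at (g x)) i)"
      using Suc.prems Ck_on_Suc_imp[OF Suc.prems(1)] by (intro Suc.IH) auto
  qed
  ultimately show ?case using frechet_derivative_chain(2)[OF g f] by simp
qed

section \<open>Closure properties of smooth maps\<close>

lemma smooth_on_cong:
  "open S \<Longrightarrow> (\<And>x. x \<in> S \<Longrightarrow> f x = g x) \<Longrightarrow> smooth_on S f \<longleftrightarrow> smooth_on S g"
  unfolding smooth_on_def by (metis Ck_on_cong)

lemma smooth_on_transform:
  "open S \<Longrightarrow> smooth_on S g \<Longrightarrow> (\<And>x. x \<in> S \<Longrightarrow> f x = g x) \<Longrightarrow> smooth_on S f"
  using smooth_on_cong[of S f g] by simp

lemma smooth_on_subset: "smooth_on S f \<Longrightarrow> T \<subseteq> S \<Longrightarrow> smooth_on T f"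
  unfolding smooth_on_def by (metis Ck_on_subset)

lemma smooth_on_const: "smooth_on S (\<lambda>x. c)"
  unfolding smooth_on_def by (simp add: Ck_on_const)

lemma smooth_on_add:
  "open S \<Longrightarrow> smooth_on S f \<Longrightarrow> smooth_on S g \<Longrightarrow> smooth_on S (\<lambda>x. f x + g x)"
  unfolding smooth_on_def by (simp add: Ck_on_add)

lemma smooth_on_scaleR:
  "open S \<Longrightarrow> smooth_on S f \<Longrightarrow> smooth_on S g \<Longrightarrow> smooth_on S (\<lambda>x. f x *\<^sub>R g x)"
  unfolding smooth_on_def by (simp add: Ck_on_scaleR)

lemma smooth_on_diff:
  assumes "open S" "smooth_on S f" "smooth_on S g"
  shows "smooth_on S (\<lambda>x. f x - g x)"
  using smooth_on_add[OF assms(1,2) smooth_on_scaleR[OF assms(1) smooth_on_const[of S "-1"] assms(3)]]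
  by simp

lemma smooth_on_bounded_linear:
  "open S \<Longrightarrow> bounded_linear L \<Longrightarrow> smooth_on S f \<Longrightarrow> smooth_on S (\<lambda>x. L (f x))"
  unfolding smooth_on_def by (simp add: Ck_on_bounded_linear)

lemma smooth_on_sum:
  "open S \<Longrightarrow> (\<And>i. i \<in> A \<Longrightarrow> smooth_on S (f i)) \<Longrightarrow> smooth_on S (\<lambda>x. \<Sum>i\<in>A. f i x)"
  unfolding smooth_on_def by (simp add: Ck_on_sum)

lemma smooth_on_compose:
  fixes g :: "'a::euclidean_space \<Rightarrow> 'b::euclidean_space" and f :: "'b \<Rightarrow> 'c::real_normed_vector"
  shows "open S \<Longrightarrow> g ` S \<subseteq> T \<Longrightarrow> smooth_on S g \<Longrightarrow> smooth_on T f \<Longrightarrow> smooth_on S (\<lambda>x. f (g x))"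
  unfolding smooth_on_def by (simp add: Ck_on_compose)

lemma smooth_on_differentiable: "smooth_on S f \<Longrightarrow> x \<in> S \<Longrightarrow> f differentiable (at x)"
  unfolding smooth_on_def by (metis Ck_on.simps(2))

lemma smooth_on_frechet_derivative:
  "smooth_on S f \<Longrightarrow> smooth_on S (\<lambda>x. frechet_derivative f (at x) v)"
  unfolding smooth_on_def by (metis Ck_on.simps(2))

lemma smooth_on_imp_continuous_on: "smooth_on S f \<Longrightarrow> continuous_on S f"
  unfolding smooth_on_def by (metis Ck_on.simps(1))

lemma frechet_derivative_field_expand:
  assumes "smooth_on S f" "x \<in> S"
  shows "frechet_derivative f (at x) v = (\<Sum>i\<in>Basis. (v \<bullet> i) *\<^sub>R frechet_derivative f (at x) i)"
  using assms by (intro linear_euclidean_expand linear_frechet_derivative smooth_on_differentiable)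

text \<open>The moving direction \<open>h x\<close> is again resolved in \<open>Basis\<close>. This
  covers a Jacobian applied to a field, as it occurs in changes of chart and in the bracket.\<close>

lemma smooth_on_frechet_derivative_field:
  fixes f :: "'a::euclidean_space \<Rightarrow> 'b::real_normed_vector"
  assumes "open S" "smooth_on S f" "smooth_on S h"
  shows "smooth_on S (\<lambda>x. frechet_derivative f (at x) (h x))"
proof -
  have "smooth_on S (\<lambda>x. \<Sum>i\<in>Basis. (h x \<bullet> i) *\<^sub>R frechet_derivative f (at x) i)"
    using assms by (intro smooth_on_sum smooth_on_scaleR smooth_on_frechet_derivative
        smooth_on_bounded_linear[OF _ bounded_linear_inner_left]) auto
  moreover have "smooth_on S (\<lambda>x. frechet_derivative f (at x) (h x)) \<longleftrightarrow>
      smooth_on S (\<lambda>x. \<Sum>i\<in>Basis. (h x \<bullet> i) *\<^sub>R frechet_derivative f (at x) i)"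
    by (intro smooth_on_cong assms(1) frechet_derivative_field_expand[OF assms(2)])
  ultimately show ?thesis by simp
qed

text \<open>Mean value theorem twice: in the direction \<open>v\<close> for the increment of
  \<open>f\<close> caused by adding \<open>s\<close> times \<open>w\<close>, then in the direction
  \<open>w\<close> for the derivative so obtained, with \<open>a\<close> fixed.\<close>

lemma second_difference_mean_value:
  fixes f :: "'a::euclidean_space \<Rightarrow> real"
  assumes f: "smooth_on S f" and s: "s > 0"
    and in_S: "\<And>a b. 0 \<le> a \<Longrightarrow> a \<le> s \<Longrightarrow> 0 \<le> b \<Longrightarrow> b \<le> s \<Longrightarrow> x + a *\<^sub>R v + b *\<^sub>R w \<in> S"
  shows "\<exists>a b. 0 \<le> a \<and> a \<le> s \<and> 0 \<le> b \<and> b \<le> s \<and>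
    f (x + s *\<^sub>R v + s *\<^sub>R w) - f (x + s *\<^sub>R v) - f (x + s *\<^sub>R w) + f x =
    s * s * frechet_derivative (\<lambda>y. frechet_derivative f (at y) v) (at (x + a *\<^sub>R v + b *\<^sub>R w)) w"
proof -
  let ?g = "\<lambda>a. f (x + a *\<^sub>R v + s *\<^sub>R w) - f (x + a *\<^sub>R v)"
  let ?Df = "\<lambda>y. frechet_derivative f (at y) v"
  have fD: "((\<lambda>a. f (x + a *\<^sub>R v + b *\<^sub>R w)) has_real_derivative ?Df (x + a *\<^sub>R v + b *\<^sub>R w)) (at a)"
    if ab: "0 \<le> a" "a \<le> s" "0 \<le> b" "b \<le> s" for a b
  proof -
    have d: "f differentiable (at (x + a *\<^sub>R v + b *\<^sub>R w))"
      using f in_S[OF ab] by (rule smooth_on_differentiable)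
    have "((\<lambda>a. x + a *\<^sub>R v + b *\<^sub>R w) has_derivative (\<lambda>h. h *\<^sub>R v)) (at a)"
      by (auto intro!: derivative_eq_intros)
    from has_derivative_compose[OF this has_derivative_frechet[OF d]]
    show ?thesis
      unfolding has_field_derivative_def
      by (simp add: linear_scale[OF linear_frechet_derivative[OF d]] mult_commute_abs)
  qed
  have g: "(?g has_real_derivative ?Df (x + a *\<^sub>R v + s *\<^sub>R w) - ?Df (x + a *\<^sub>R v)) (at a)"
    if "0 \<le> a" "a \<le> s" for a
    using DERIV_diff[OF fD[OF that] fD[OF that], of s 0] s by simp
  then obtain a where a: "0 < a" "a < s"
    and ga: "?g s - ?g 0 = (s - 0) * (?Df (x + a *\<^sub>R v + s *\<^sub>R w) - ?Df (x + a *\<^sub>R v))"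
    using MVT2[OF s g] by blast
  have h: "((\<lambda>b. ?Df (x + a *\<^sub>R v + b *\<^sub>R w)) has_real_derivative
      frechet_derivative ?Df (at (x + a *\<^sub>R v + b *\<^sub>R w)) w) (at b)"
    if b: "0 \<le> b" "b \<le> s" for b
  proof -
    have d: "?Df differentiable (at (x + a *\<^sub>R v + b *\<^sub>R w))"
      using f in_S a b by (intro smooth_on_differentiable[OF smooth_on_frechet_derivative]) auto
    have "((\<lambda>b. x + a *\<^sub>R v + b *\<^sub>R w) has_derivative (\<lambda>h. h *\<^sub>R w)) (at b)"
      by (auto intro!: derivative_eq_intros)
    from has_derivative_compose[OF this has_derivative_frechet[OF d]]
    show ?thesis
      unfolding has_field_derivative_def
      by (simp add: linear_scale[OF linear_frechet_derivative[OF d]] mult_commute_abs)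
  qed
  then obtain b where b: "0 < b" "b < s"
    and gb: "?Df (x + a *\<^sub>R v + s *\<^sub>R w) - ?Df (x + a *\<^sub>R v + 0 *\<^sub>R w) =
      (s - 0) * frechet_derivative ?Df (at (x + a *\<^sub>R v + b *\<^sub>R w)) w"
    using MVT2[OF s h] by auto
  show ?thesis
    using a b ga gb by (intro exI[of _ a] exI[of _ b]) (simp add: algebra_simps)
qed

text \<open>The second difference at \<open>x\<close> does not change when \<open>v\<close> and
  \<open>w\<close> are swapped. So one mixed derivative at some point equals the other at a second
  point, both points being as close to \<open>x\<close> as desired, and continuity of the mixed
  derivatives does the rest.\<close>

lemma second_derivative_symmetric_real:
  fixes f :: "'a::euclidean_space \<Rightarrow> real"
  assumes "open S" "x \<in> S" and f: "smooth_on S f"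
  shows "frechet_derivative (\<lambda>y. frechet_derivative f (at y) v) (at x) w =
    frechet_derivative (\<lambda>y. frechet_derivative f (at y) w) (at x) v"
proof (rule ccontr)
  let ?D = "\<lambda>v w y. frechet_derivative (\<lambda>y. frechet_derivative f (at y) v) (at y) w"
  assume "?D v w x \<noteq> ?D w v x"
  \<comment> \<open>Half the gap: no number is closer than this to both mixed derivatives at
    \<open>x\<close>.\<close>
  then have e: "\<bar>?D v w x - ?D w v x\<bar> / 2 > 0" (is "?e > 0") by simp
  have cont: "\<exists>d>0. \<forall>y. dist y x < d \<longrightarrow> \<bar>?D v w y - ?D v w x\<bar> < ?e" for v w
  proof -
    have "continuous_on S (?D v w)"
      using f by (intro smooth_on_imp_continuous_on smooth_on_frechet_derivative)
    then have "continuous (at x) (?D v w)"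
      using assms(1,2) continuous_on_eq_continuous_at by blast
    then show ?thesis using e unfolding continuous_at_eps_delta dist_real_def by blast
  qed
  obtain d1 where d1: "d1 > 0" "\<And>y. dist y x < d1 \<Longrightarrow> \<bar>?D v w y - ?D v w x\<bar> < ?e"
    using cont[of v w] by blast
  obtain d2 where d2: "d2 > 0" "\<And>y. dist y x < d2 \<Longrightarrow> \<bar>?D w v y - ?D w v x\<bar> < ?e"
    using cont[of w v] by blast
  obtain d3 where d3: "d3 > 0" "ball x d3 \<subseteq> S"
    using assms(1,2) openE by blast
  define d where "d = min d1 (min d2 d3)"
  \<comment> \<open>Keeps the parallelogram spanned at \<open>x\<close> by \<open>s\<close> times
    \<open>v\<close> and \<open>s\<close> times \<open>w\<close> within distance \<open>d\<close>;
    the summand 1 avoids division by zero and makes the bound strict.\<close>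
  define s where "s = d / (norm v + norm w + 1)"
  have pos: "norm v + norm w + 1 > 0" by (smt (verit) norm_ge_zero)
  have d: "d > 0" using d1 d2 d3 by (simp add: d_def)
  then have s: "s > 0" using pos by (simp add: s_def)
  have near: "dist (x + a *\<^sub>R v + b *\<^sub>R w) x < d" if "0 \<le> a" "a \<le> s" "0 \<le> b" "b \<le> s" for a b
  proof -
    have "dist (x + a *\<^sub>R v + b *\<^sub>R w) x \<le> a * norm v + b * norm w"
      using norm_triangle_ineq[of "a *\<^sub>R v" "b *\<^sub>R w"] that by (simp add: dist_norm)
    also have "\<dots> \<le> s * norm v + s * norm w"
      using that by (intro add_mono mult_right_mono) auto
    also have "\<dots> < s * (norm v + norm w + 1)" using s by (simp add: algebra_simps)
    also have "\<dots> = d" using pos by (simp add: s_def)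
    finally show ?thesis .
  qed
  then have in_S: "x + a *\<^sub>R v + b *\<^sub>R w \<in> S" if "0 \<le> a" "a \<le> s" "0 \<le> b" "b \<le> s" for a b
    using that d3 by (force simp: d_def dist_commute)
  then have in_S': "x + a *\<^sub>R w + b *\<^sub>R v \<in> S" if "0 \<le> a" "a \<le> s" "0 \<le> b" "b \<le> s" for a b
    using in_S[of b a] that by (simp add: add_ac)
  obtain a b where ab: "0 \<le> a" "a \<le> s" "0 \<le> b" "b \<le> s"
    and 1: "f (x + s *\<^sub>R v + s *\<^sub>R w) - f (x + s *\<^sub>R v) - f (x + s *\<^sub>R w) + f x =
      s * s * ?D v w (x + a *\<^sub>R v + b *\<^sub>R w)"
    using second_difference_mean_value[OF f s in_S] by blast
  obtain a' b' where ab': "0 \<le> a'" "a' \<le> s" "0 \<le> b'" "b' \<le> s"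
    and 2: "f (x + s *\<^sub>R w + s *\<^sub>R v) - f (x + s *\<^sub>R w) - f (x + s *\<^sub>R v) + f x =
      s * s * ?D w v (x + a' *\<^sub>R w + b' *\<^sub>R v)"
    using second_difference_mean_value[OF f s in_S'] by blast
  have "x + s *\<^sub>R w + s *\<^sub>R v = x + s *\<^sub>R v + s *\<^sub>R w" by simp
  from 1 2[unfolded this]
  have "s * s * ?D v w (x + a *\<^sub>R v + b *\<^sub>R w) = s * s * ?D w v (x + a' *\<^sub>R w + b' *\<^sub>R v)"
    by linarith
  then have "?D v w (x + a *\<^sub>R v + b *\<^sub>R w) = ?D w v (x + a' *\<^sub>R w + b' *\<^sub>R v)"
    using s by simp
  moreover have "\<bar>?D v w (x + a *\<^sub>R v + b *\<^sub>R w) - ?D v w x\<bar> < ?e"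
    using near[OF ab] by (intro d1) (simp add: d_def)
  moreover have "\<bar>?D w v (x + a' *\<^sub>R w + b' *\<^sub>R v) - ?D w v x\<bar> < ?e"
    using near[OF ab'(3,4,1,2)] by (intro d2) (simp add: d_def add_ac)
  ultimately show False by (simp add: abs_if split: if_splits)
qed

text \<open>Reduction to real functions: the inner product with a basis vector commutes with
  differentiation.\<close>

lemma second_derivative_symmetric:
  fixes f :: "'a::euclidean_space \<Rightarrow> 'b::euclidean_space"
  assumes "open S" "x \<in> S" and f: "smooth_on S f"
  shows "frechet_derivative (\<lambda>y. frechet_derivative f (at y) v) (at x) w =
    frechet_derivative (\<lambda>y. frechet_derivative f (at y) w) (at x) v"
proof (rule euclidean_eqI)
  fix i :: 'b
  assume "i \<in> Basis"
  have inner: "frechet_derivative (\<lambda>y. h y \<bullet> i) (at y) u = frechet_derivative h (at y) u \<bullet> i"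
    if h: "smooth_on S h" "y \<in> S" for h :: "'a \<Rightarrow> 'b" and y u
  proof -
    have "((\<lambda>y. h y \<bullet> i) has_derivative (\<lambda>u. frechet_derivative h (at y) u \<bullet> i)) (at y)"
      by (intro bounded_linear.has_derivative[OF bounded_linear_inner_left] has_derivative_frechet
          smooth_on_differentiable[OF h])
    then show ?thesis by (rule frechet_derivative_eqI)
  qed
  have "frechet_derivative (\<lambda>y. frechet_derivative f (at y) v) (at x) w \<bullet> i =
      frechet_derivative (\<lambda>y. frechet_derivative (\<lambda>y. f y \<bullet> i) (at y) v) (at x) w" for v w
  proof -
    have "frechet_derivative (\<lambda>y. frechet_derivative (\<lambda>y. f y \<bullet> i) (at y) v) (at x) =
        frechet_derivative (\<lambda>y. frechet_derivative f (at y) v \<bullet> i) (at x)"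
      by (rule frechet_derivative_cong_open[OF assms(1,2) inner[OF f]])
    then show ?thesis
      by (simp add: inner[OF smooth_on_frechet_derivative[OF f] assms(2)])
  qed
  moreover have "smooth_on S (\<lambda>y. f y \<bullet> i)"
    by (rule smooth_on_bounded_linear[OF assms(1) bounded_linear_inner_left f])
  ultimately show "frechet_derivative (\<lambda>y. frechet_derivative f (at y) v) (at x) w \<bullet> i =
      frechet_derivative (\<lambda>y. frechet_derivative f (at y) w) (at x) v \<bullet> i"
    using second_derivative_symmetric_real[OF assms(1,2)] by metis
qed

text \<open>Product rule for the matrix field \<open>DF\<close> applied to the vector field
  \<open>Y\<close>: the first summand is the second derivative of \<open>F\<close> with
  \<open>Y\<close> frozen at \<open>x\<close>, the second differentiates \<open>Y\<close>.\<close>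

lemma frechet_derivative_of_pushforward:
  fixes F :: "'a::euclidean_space \<Rightarrow> 'b::euclidean_space"
  assumes "open S" "x \<in> S" and F: "smooth_on S F" and Y: "Y differentiable (at x)"
  shows "(\<lambda>y. frechet_derivative F (at y) (Y y)) differentiable (at x)"
    and "frechet_derivative (\<lambda>y. frechet_derivative F (at y) (Y y)) (at x) v =
      frechet_derivative (\<lambda>y. frechet_derivative F (at y) (Y x)) (at x) v +
      frechet_derivative F (at x) (frechet_derivative Y (at x) v)"
proof -
  let ?D = "\<lambda>y. frechet_derivative F (at y)"
  let ?P = "\<lambda>y. \<Sum>i\<in>Basis. (Y y \<bullet> i) *\<^sub>R ?D y i"
  have D: "(\<lambda>y. ?D y i) differentiable (at x)" for i
    using F assms(2) by (intro smooth_on_differentiable[OF smooth_on_frechet_derivative])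
  \<comment> \<open>The term with a frozen direction is expanded in the same basis, so that it can
    be recognized in the derivative of \<open>?P\<close>.\<close>
  have const: "frechet_derivative (\<lambda>y. ?D y u) (at x) v =
      (\<Sum>i\<in>Basis. (u \<bullet> i) *\<^sub>R frechet_derivative (\<lambda>y. ?D y i) (at x) v)" for u v
  proof -
    have "((\<lambda>y. \<Sum>i\<in>Basis. (u \<bullet> i) *\<^sub>R ?D y i) has_derivative
        (\<lambda>v. \<Sum>i\<in>Basis. (u \<bullet> i) *\<^sub>R frechet_derivative (\<lambda>y. ?D y i) (at x) v)) (at x)"
      by (intro has_derivative_sum has_derivative_scaleR_right has_derivative_frechet D)
    moreover have "frechet_derivative (\<lambda>y. ?D y u) (at x) =
        frechet_derivative (\<lambda>y. \<Sum>i\<in>Basis. (u \<bullet> i) *\<^sub>R ?D y i) (at x)"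
      by (rule frechet_derivative_cong_open[OF assms(1,2) frechet_derivative_field_expand[OF F]])
    ultimately show ?thesis by (simp add: frechet_derivative_eqI)
  qed
  have P: "(?P has_derivative (\<lambda>v. \<Sum>i\<in>Basis. (Y x \<bullet> i) *\<^sub>R frechet_derivative (\<lambda>y. ?D y i) (at x) v +
      (frechet_derivative Y (at x) v \<bullet> i) *\<^sub>R ?D x i)) (at x)"
    by (intro has_derivative_sum has_derivative_scaleR has_derivative_frechet D
        bounded_linear.has_derivative[OF bounded_linear_inner_left] Y)
  have eq: "?D y (Y y) = ?P y" if "y \<in> S" for y
    by (rule frechet_derivative_field_expand[OF F that])
  show "(\<lambda>y. ?D y (Y y)) differentiable (at x)"
    by (rule differentiable_cong_open[OF assms(1,2) eq]) (use P in \<open>auto simp: differentiable_def\<close>)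
  have "frechet_derivative (\<lambda>y. ?D y (Y y)) (at x) = frechet_derivative ?P (at x)"
    by (rule frechet_derivative_cong_open[OF assms(1,2) eq])
  then show "frechet_derivative (\<lambda>y. ?D y (Y y)) (at x) v =
      frechet_derivative (\<lambda>y. ?D y (Y x)) (at x) v + ?D x (frechet_derivative Y (at x) v)"
    by (simp only: frechet_derivative_eqI[OF P] sum.distrib const[of "Y x"]
        frechet_derivative_field_expand[OF F assms(2), of "frechet_derivative Y (at x) v"])
qed

text \<open>The terms with frozen fields are \<open>D^2 F (X, Y)\<close> and
  \<open>D^2 F (Y, X)\<close>, which cancel by symmetry. For a transition map this is the chart
  independence of the bracket; for the immersion in coordinates it gives torsion-freeness along
  \<open>f\<close>.\<close>

lemma bracket_of_pushforward:
  fixes F :: "'a::euclidean_space \<Rightarrow> 'b::euclidean_space"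
  assumes "open S" "x \<in> S" "smooth_on S F" "X differentiable (at x)" "Y differentiable (at x)"
  shows "frechet_derivative (\<lambda>y. frechet_derivative F (at y) (Y y)) (at x) (X x) -
      frechet_derivative (\<lambda>y. frechet_derivative F (at y) (X y)) (at x) (Y x) =
    frechet_derivative F (at x) (frechet_derivative Y (at x) (X x) - frechet_derivative X (at x) (Y x))"
  using frechet_derivative_of_pushforward(2)[OF assms(1,2,3,5)]
    frechet_derivative_of_pushforward(2)[OF assms(1,2,3,4)]
    second_derivative_symmetric[OF assms(1,2,3), of "X x" "Y x"]
    linear_diff[OF linear_frechet_derivative[OF smooth_on_differentiable[OF assms(3,2)]]]
  by simp

section \<open>Manifolds and vector fields\<close>

abbreviation field_components ::
    "('a, 'e::euclidean_space) manifold \<Rightarrow> ('a, 'e) chart \<Rightarrow> ('a \<Rightarrow> 'e) \<Rightarrow> 'e \<Rightarrow> 'e" where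
  "field_components M c X \<equiv> (\<lambda>q. tan_coord M c q (X q)) \<circ> chart_inv c"

section \<open>Charts, Jacobians, smooth fields and the bracket in a fixed chart\<close>

context smooth_manifold
begin

lemma chart_subset: "c \<in> atlas M \<Longrightarrow> fst c \<subseteq> points M"
  by (simp add: chart_open openin_subset)

lemma chart_inv_left:
  assumes "c \<in> atlas M" "q \<in> fst c"
  shows "chart_inv c (snd c q) = q"
proof -
  have "inj_on (snd c) (fst c)"
    using homeomorphic_imp_injective_map[OF chart_homeo[OF assms(1)]] chart_subset[OF assms(1)]
    by (simp add: Int_absorb1)
  then show ?thesis using assms(2) by (simp add: chart_inv_def)
qed

lemma open_chart_image:
  assumes "c \<in> atlas M" "openin (mtop M) U"
  shows "open (snd c ` (fst c \<inter> U))"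
proof -
  have "openin (subtopology (mtop M) (fst c)) (fst c \<inter> U)"
    using assms(2) openin_subtopology_Int2 by blast
  then have "openin (top_of_set (snd c ` fst c)) (snd c ` (fst c \<inter> U))"
    using homeomorphic_imp_open_map[OF chart_homeo[OF assms(1)]] by (simp add: open_map_def)
  then show ?thesis
    using chart_image_open[OF assms(1)] openin_open_eq by blast
qed

lemma chart_at:
  assumes "p \<in> points M"
  shows "chart_at M p \<in> atlas M" "p \<in> fst (chart_at M p)"
proof -
  have "\<exists>c. c \<in> atlas M \<and> p \<in> fst c" using assms charts_cover by blast
  from someI_ex[OF this] show "chart_at M p \<in> atlas M" "p \<in> fst (chart_at M p)"
    unfolding chart_at_def by auto
qed

lemma transition_differentiable:
  assumes "a \<in> atlas M" "b \<in> atlas M" "q \<in> fst a" "q \<in> fst b"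
  shows "(snd b \<circ> chart_inv a) differentiable (at (snd a q))"
  using smooth_on_differentiable[OF charts_compatible[OF assms(1,2)]] assms by blast

text \<open>Chain rule through the transition map from \<open>a\<close> to \<open>b\<close>. With
  \<open>G\<close> a coordinate map it is the cocycle rule for Jacobians; with \<open>G\<close> the
  components of a field it moves a directional derivative to another chart.\<close>

lemma change_chart:
  assumes ab: "a \<in> atlas M" "b \<in> atlas M" and q: "q \<in> fst a" "q \<in> fst b"
    and G: "(G \<circ> chart_inv b) differentiable (at (snd b q))"
  shows "frechet_derivative (G \<circ> chart_inv a) (at (snd a q)) v =
      frechet_derivative (G \<circ> chart_inv b) (at (snd b q))
        (frechet_derivative (snd b \<circ> chart_inv a) (at (snd a q)) v)"
    and "(G \<circ> chart_inv a) differentiable (at (snd a q))"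
proof -
  let ?S = "snd a ` (fst a \<inter> fst b)"
  let ?H = "\<lambda>y. (G \<circ> chart_inv b) ((snd b \<circ> chart_inv a) y)"
  have S: "open ?S" "snd a q \<in> ?S"
    using open_chart_image[OF ab(1) chart_open[OF ab(2)]] q by auto
  have eq: "(G \<circ> chart_inv a) y = ?H y" if "y \<in> ?S" for y
    using that ab by (auto simp: chart_inv_left)
  have tq: "(snd b \<circ> chart_inv a) (snd a q) = snd b q"
    by (simp add: chart_inv_left[OF ab(1) q(1)])
  have G': "(G \<circ> chart_inv b) differentiable (at ((snd b \<circ> chart_inv a) (snd a q)))"
    unfolding tq by (rule G)
  note chain = frechet_derivative_chain[OF transition_differentiable[OF ab q] G']
  have D: "frechet_derivative (G \<circ> chart_inv a) (at (snd a q)) = frechet_derivative ?H (at (snd a q))"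
    by (rule frechet_derivative_cong_open[OF S eq])
  show "frechet_derivative (G \<circ> chart_inv a) (at (snd a q)) v =
      frechet_derivative (G \<circ> chart_inv b) (at (snd b q))
        (frechet_derivative (snd b \<circ> chart_inv a) (at (snd a q)) v)"
    using chain(1)[of v] unfolding D tq .
  show "(G \<circ> chart_inv a) differentiable (at (snd a q))"
    by (rule differentiable_cong_open[OF S eq chain(2)])
qed

text \<open>The composite is known to be the identity only on the image of the chart, so the
  derivatives are compared on that open set.\<close>

lemma transition_self:
  assumes "b \<in> atlas M" "q \<in> fst b"
  shows "frechet_derivative (snd b \<circ> chart_inv b) (at (snd b q)) w = w"
proof -
  have "frechet_derivative (snd b \<circ> chart_inv b) (at (snd b q)) = frechet_derivative (\<lambda>x. x) (at (snd b q))"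
    by (rule frechet_derivative_cong_open[OF chart_image_open[OF assms(1)]])
      (use assms in \<open>auto simp: chart_inv_left\<close>)
  then show ?thesis by simp
qed

lemma tan_coord_change:
  assumes "b \<in> atlas M" "c \<in> atlas M" "q \<in> fst b" "q \<in> fst c"
  shows "tan_coord M c q v = frechet_derivative (snd c \<circ> chart_inv b) (at (snd b q)) (tan_coord M b q v)"
proof -
  have "q \<in> points M" using assms chart_subset by blast
  then show ?thesis
    unfolding tan_coord_def
    by (intro change_chart(1) chart_at transition_differentiable assms)
qed

lemma tan_coord_coord_field:
  assumes "b \<in> atlas M" "c \<in> atlas M" "q \<in> fst b" "q \<in> fst c"
  shows "tan_coord M c q (coord_field M b w q) = frechet_derivative (snd c \<circ> chart_inv b) (at (snd b q)) w"
proof -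
  have "q \<in> points M" using assms chart_subset by blast
  then show ?thesis
    unfolding tan_coord_def coord_field_def
    by (intro change_chart(1)[symmetric] chart_at transition_differentiable assms)
qed

lemma tan_coord_coord_field_same:
  "b \<in> atlas M \<Longrightarrow> q \<in> fst b \<Longrightarrow> tan_coord M b q (coord_field M b w q) = w"
  by (simp add: tan_coord_coord_field transition_self)

lemma tan_coord_chart_at: "q \<in> points M \<Longrightarrow> tan_coord M (chart_at M q) q v = v"
  unfolding tan_coord_def by (intro transition_self chart_at)

lemma coord_field_chart_at: "q \<in> points M \<Longrightarrow> coord_field M (chart_at M q) w q = w"
  unfolding coord_field_def by (intro transition_self chart_at)

text \<open>Cocycle rule into the preferred chart at \<open>q\<close>, where
  \<open>tan_coord\<close> is the identity.\<close>

lemma coord_field_tan_coord: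
  assumes "c \<in> atlas M" "q \<in> fst c"
  shows "coord_field M c (tan_coord M c q v) q = v"
proof -
  have q: "q \<in> points M" using assms chart_subset by blast
  show ?thesis
    using tan_coord_change[OF assms(1) chart_at(1)[OF q] assms(2) chart_at(2)[OF q], of v]
    by (simp add: coord_field_def tan_coord_chart_at[OF q])
qed

lemma linear_tan_coord:
  assumes "c \<in> atlas M" "q \<in> fst c"
  shows "linear (tan_coord M c q)"
proof -
  have "q \<in> points M" using assms chart_subset by blast
  then show ?thesis
    unfolding tan_coord_def using assms
    by (intro linear_frechet_derivative transition_differentiable chart_at)
qed

lemma linear_coord_field:
  assumes "c \<in> atlas M" "q \<in> fst c"
  shows "linear (\<lambda>w. coord_field M c w q)"
proof -
  have "q \<in> points M" using assms chart_subset by blast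
  then show ?thesis
    unfolding coord_field_def using assms
    by (intro linear_frechet_derivative transition_differentiable chart_at)
qed

lemma smooth_vf_on_components:
  "smooth_vf_on M U X \<Longrightarrow> c \<in> atlas M \<Longrightarrow> smooth_on (snd c ` (fst c \<inter> U)) (field_components M c X)"
  by (simp add: smooth_vf_on_def)

lemma smooth_vf_on_components_differentiable:
  "smooth_vf_on M U X \<Longrightarrow> c \<in> atlas M \<Longrightarrow> q \<in> fst c \<Longrightarrow> q \<in> U \<Longrightarrow>
    field_components M c X differentiable (at (snd c q))"
  by (blast intro: smooth_on_differentiable smooth_vf_on_components)

lemma components_at_chart:
  "c \<in> atlas M \<Longrightarrow> q \<in> fst c \<Longrightarrow> field_components M c X (snd c q) = tan_coord M c q (X q)"
  by (simp add: chart_inv_left)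

text \<open>Smoothness in one chart whose domain contains \<open>U\<close> suffices: in another
  chart \<open>c\<close> the components are those in \<open>b\<close>, multiplied by the Jacobian of
  \<open>?F\<close> and precomposed with the transition \<open>?t\<close>.\<close>

lemma smooth_vf_on_chartI:
  assumes b: "b \<in> atlas M" and U: "openin (mtop M) U" "U \<subseteq> fst b"
    and X: "smooth_on (snd b ` U) (field_components M b X)"
  shows "smooth_vf_on M U X"
  unfolding smooth_vf_on_def
proof
  fix c assume c: "c \<in> atlas M"
  let ?t = "snd b \<circ> chart_inv c"
  let ?F = "snd c \<circ> chart_inv b"
  let ?H = "\<lambda>z. frechet_derivative ?F (at z) (field_components M b X z)"
  have openS: "open (snd c ` (fst c \<inter> U))" using open_chart_image[OF c U(1)] .
  have "open (snd b ` (fst b \<inter> (fst c \<inter> U)))"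
    using open_chart_image[OF b] U(1) chart_open[OF c] by blast
  then have openT: "open (snd b ` (fst c \<inter> U))"
    using U(2) by (simp add: Int_absorb1 le_infI2)
  have "smooth_on (snd b ` (fst c \<inter> U)) ?H"
  proof (rule smooth_on_frechet_derivative_field[OF openT])
    show "smooth_on (snd b ` (fst c \<inter> U)) ?F"
      by (rule smooth_on_subset[OF charts_compatible[OF b c]]) (use U in auto)
    show "smooth_on (snd b ` (fst c \<inter> U)) (field_components M b X)"
      by (rule smooth_on_subset[OF X]) auto
  qed
  moreover have "smooth_on (snd c ` (fst c \<inter> U)) ?t"
    by (rule smooth_on_subset[OF charts_compatible[OF c b]]) (use U in auto)
  moreover have "?t ` snd c ` (fst c \<inter> U) \<subseteq> snd b ` (fst c \<inter> U)"
    using chart_inv_left[OF c] by auto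
  ultimately have "smooth_on (snd c ` (fst c \<inter> U)) (\<lambda>y. ?H (?t y))"
    using smooth_on_compose[OF openS, of ?t "snd b ` (fst c \<inter> U)" ?H] by blast
  moreover have "field_components M c X y = ?H (?t y)" if y: "y \<in> snd c ` (fst c \<inter> U)" for y
  proof -
    from y obtain q where q: "q \<in> fst c" "q \<in> U" and "y = snd c q" by blast
    then show ?thesis
      using tan_coord_change[OF b c _ q(1), of "X q"] U(2) b c by (auto simp: chart_inv_left)
  qed
  ultimately show "smooth_on (snd c ` (fst c \<inter> U)) (field_components M c X)"
    by (rule smooth_on_transform[OF openS])
qed

lemma smooth_fun_on_chartI:
  assumes b: "b \<in> atlas M" and U: "openin (mtop M) U" "U \<subseteq> fst b"
    and h: "smooth_on (snd b ` U) (h \<circ> chart_inv b)"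
  shows "smooth_fun_on M U h"
  unfolding smooth_fun_on_def
proof
  fix c assume c: "c \<in> atlas M"
  let ?t = "snd b \<circ> chart_inv c"
  have openS: "open (snd c ` (fst c \<inter> U))" using open_chart_image[OF c U(1)] .
  have "smooth_on (snd c ` (fst c \<inter> U)) ?t"
    by (rule smooth_on_subset[OF charts_compatible[OF c b]]) (use U in auto)
  moreover have "?t ` snd c ` (fst c \<inter> U) \<subseteq> snd b ` U"
    using chart_inv_left[OF c] by auto
  ultimately have "smooth_on (snd c ` (fst c \<inter> U)) (\<lambda>y. (h \<circ> chart_inv b) (?t y))"
    using smooth_on_compose[OF openS _ _ h, of ?t] by blast
  moreover have "(h \<circ> chart_inv c) y = (h \<circ> chart_inv b) (?t y)" if "y \<in> snd c ` (fst c \<inter> U)" for y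
    using that U b c by (auto simp: chart_inv_left)
  ultimately show "smooth_on (snd c ` (fst c \<inter> U)) (h \<circ> chart_inv c)"
    by (rule smooth_on_transform[OF openS])
qed

lemma smooth_fun_on_const: "smooth_fun_on M U (\<lambda>x. k)"
  by (simp add: smooth_fun_on_def o_def smooth_on_const)

lemma smooth_vf_on_cong:
  assumes "openin (mtop M) U" "\<And>x. x \<in> U \<Longrightarrow> X x = Y x" "smooth_vf_on M U X"
  shows "smooth_vf_on M U Y"
  unfolding smooth_vf_on_def
proof
  fix c assume c: "c \<in> atlas M"
  have eq: "field_components M c Y y = field_components M c X y" if "y \<in> snd c ` (fst c \<inter> U)" for y
    using that assms(2) c by (auto simp: chart_inv_left)
  show "smooth_on (snd c ` (fst c \<inter> U)) (field_components M c Y)"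
    by (rule smooth_on_transform[OF open_chart_image[OF c assms(1)] smooth_vf_on_components[OF assms(3) c] eq])
qed

text \<open>Sum and multiple in one statement: \<open>Y = 0\<close> gives multiples, and the form is
  that of the induction step for finite combinations.\<close>

lemma smooth_vf_on_scale_add:
  assumes U: "openin (mtop M) U" and "smooth_fun_on M U h" "smooth_vf_on M U X" "smooth_vf_on M U Y"
  shows "smooth_vf_on M U (\<lambda>x. h x *\<^sub>R X x + Y x)"
  unfolding smooth_vf_on_def
proof
  fix c assume c: "c \<in> atlas M"
  have S: "open (snd c ` (fst c \<inter> U))" using open_chart_image[OF c U] .
  have "smooth_on (snd c ` (fst c \<inter> U)) (h \<circ> chart_inv c)"
    using assms(2) c by (simp add: smooth_fun_on_def)
  then have "smooth_on (snd c ` (fst c \<inter> U)) (\<lambda>y. (h \<circ> chart_inv c) y *\<^sub>R field_components M c X y + field_components M c Y y)"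
    by (intro smooth_on_add smooth_on_scaleR S smooth_vf_on_components assms c)
  moreover have "field_components M c (\<lambda>x. h x *\<^sub>R X x + Y x) y =
      (h \<circ> chart_inv c) y *\<^sub>R field_components M c X y + field_components M c Y y"
    if "y \<in> snd c ` (fst c \<inter> U)" for y
    using that c linear_tan_coord[OF c] by (auto simp: chart_inv_left linear_add linear_scale)
  ultimately show "smooth_on (snd c ` (fst c \<inter> U)) (field_components M c (\<lambda>x. h x *\<^sub>R X x + Y x))"
    by (rule smooth_on_transform[OF S])
qed

lemma smooth_vf_on_zero:
  assumes U: "openin (mtop M) U"
  shows "smooth_vf_on M U (\<lambda>x. 0)"
  unfolding smooth_vf_on_def
proof
  fix c assume c: "c \<in> atlas M"
  have eq: "field_components M c (\<lambda>x. 0) y = 0" if "y \<in> snd c ` (fst c \<inter> U)" for y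
    using that c linear_tan_coord[OF c] by (auto simp: chart_inv_left linear_0)
  show "smooth_on (snd c ` (fst c \<inter> U)) (field_components M c (\<lambda>x. 0))"
    by (rule smooth_on_transform[OF open_chart_image[OF c U] smooth_on_const eq])
qed

lemma smooth_vf_on_scale:
  assumes "openin (mtop M) U" "smooth_fun_on M U h" "smooth_vf_on M U X"
  shows "smooth_vf_on M U (\<lambda>x. h x *\<^sub>R X x)"
  using smooth_vf_on_scale_add[OF assms smooth_vf_on_zero[OF assms(1)]] by simp

lemma smooth_vf_on_combination:
  assumes U: "openin (mtop M) U" and "finite A"
    and "\<And>i. i \<in> A \<Longrightarrow> smooth_fun_on M U (h i)" "\<And>i. i \<in> A \<Longrightarrow> smooth_vf_on M U (E i)"
  shows "smooth_vf_on M U (\<lambda>x. \<Sum>i\<in>A. h i x *\<^sub>R E i x)"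
  using assms(2-4)
  by (induction A rule: finite_induct) (simp_all add: smooth_vf_on_zero[OF U] smooth_vf_on_scale_add[OF U])

lemma components_coord_field:
  assumes "b \<in> atlas M" "y \<in> snd b ` fst b"
  shows "field_components M b (coord_field M b w) y = w"
  using assms by (auto simp: chart_inv_left tan_coord_coord_field_same)

lemma frechet_derivative_components_coord_field:
  assumes "b \<in> atlas M" "p \<in> fst b"
  shows "frechet_derivative (field_components M b (coord_field M b w)) (at (snd b p)) v = 0"
proof -
  have "frechet_derivative (field_components M b (coord_field M b w)) (at (snd b p)) =
      frechet_derivative (\<lambda>y. w) (at (snd b p))"
    using assms(2)
    by (intro frechet_derivative_cong_open[OF chart_image_open[OF assms(1)]]
        components_coord_field[OF assms(1)]) auto
  then show ?thesis by simp
qed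

lemma smooth_vf_on_coord_field:
  assumes b: "b \<in> atlas M"
  shows "smooth_vf_on M (fst b) (coord_field M b w)"
proof (rule smooth_vf_on_chartI[OF b chart_open[OF b] subset_refl])
  show "smooth_on (snd b ` fst b) (field_components M b (coord_field M b w))"
    by (rule smooth_on_transform[OF chart_image_open[OF b] smooth_on_const components_coord_field[OF b]])
qed

lemma vf_expand_coord_field:
  assumes "b \<in> atlas M" "x \<in> fst b"
  shows "v = (\<Sum>i\<in>Basis. (tan_coord M b x v \<bullet> i) *\<^sub>R coord_field M b i x)"
  using linear_euclidean_expand[OF linear_coord_field[OF assms], of "tan_coord M b x v"]
  by (simp add: coord_field_tan_coord[OF assms])

lemma smooth_fun_on_component:
  assumes b: "b \<in> atlas M" and Y: "smooth_vf_on M (fst b) Y"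
  shows "smooth_fun_on M (fst b) (\<lambda>x. tan_coord M b x (Y x) \<bullet> i)"
proof (rule smooth_fun_on_chartI[OF b chart_open[OF b] subset_refl])
  have "smooth_on (snd b ` fst b) (field_components M b Y)"
    using smooth_vf_on_components[OF Y b] by (simp only: Int_absorb)
  then have "smooth_on (snd b ` fst b) (\<lambda>y. field_components M b Y y \<bullet> i)"
    by (rule smooth_on_bounded_linear[OF chart_image_open[OF b] bounded_linear_inner_left])
  then show "smooth_on (snd b ` fst b) ((\<lambda>x. tan_coord M b x (Y x) \<bullet> i) \<circ> chart_inv b)"
    by (simp add: o_def)
qed

text \<open>The bracket at \<open>p\<close> is defined in the chart preferred at \<open>p\<close>.
  Passing to \<open>c\<close> is a pushforward by the transition map, so the same formula holds in
  any fixed chart; only in this form can smoothness be read off.\<close>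

lemma tan_coord_lie_bracket:
  assumes U: "openin (mtop M) U" "p \<in> U" and c: "c \<in> atlas M" "p \<in> fst c"
    and X: "smooth_vf_on M U X" and Y: "smooth_vf_on M U Y"
  shows "tan_coord M c p (lie_bracket M X Y p) =
    frechet_derivative (field_components M c Y) (at (snd c p)) (tan_coord M c p (X p)) -
    frechet_derivative (field_components M c X) (at (snd c p)) (tan_coord M c p (Y p))"
proof -
  have p: "p \<in> points M" using c chart_subset by blast
  define a where "a = chart_at M p"
  note a = chart_at[OF p, folded a_def]
  define F where "F = snd c \<circ> chart_inv a"
  let ?S = "snd a ` (fst a \<inter> (fst c \<inter> U))"
  have S: "open ?S" "snd a p \<in> ?S"
    using open_chart_image[OF a(1), of "fst c \<inter> U"] U chart_open[OF c(1)] a c by auto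
  have F: "smooth_on ?S F"
    unfolding F_def by (rule smooth_on_subset[OF charts_compatible[OF a(1) c(1)]]) auto
  \<comment> \<open>Near \<open>p\<close> the components of \<open>Z\<close> in \<open>c\<close>,
    read in the chart \<open>a\<close>, are the Jacobian of \<open>F\<close> applied to its
    components in \<open>a\<close>; the chain rule turns their derivative into one taken in
    \<open>c\<close>.\<close>
  have push: "frechet_derivative (\<lambda>y. frechet_derivative F (at y) (field_components M a Z y)) (at (snd a p)) v =
      frechet_derivative (field_components M c Z) (at (snd c p)) (tan_coord M c p v)"
    if Z: "smooth_vf_on M U Z" for Z v
  proof -
    have "frechet_derivative F (at y) (field_components M a Z y) = ((\<lambda>q. tan_coord M c q (Z q)) \<circ> chart_inv a) y"
      if "y \<in> ?S" for y
      using that a(1) c(1) tan_coord_change[OF a(1) c(1)] by (auto simp: chart_inv_left F_def)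
    then have "frechet_derivative (\<lambda>y. frechet_derivative F (at y) (field_components M a Z y)) (at (snd a p)) v =
        frechet_derivative ((\<lambda>q. tan_coord M c q (Z q)) \<circ> chart_inv a) (at (snd a p)) v"
      by (intro fun_cong[OF frechet_derivative_cong_open[OF S]])
    also have "\<dots> = frechet_derivative (field_components M c Z) (at (snd c p))
        (frechet_derivative F (at (snd a p)) v)"
      unfolding F_def
      using change_chart(1)[OF a(1) c(1) a(2) c(2) smooth_vf_on_components_differentiable[OF Z c U(2)]] .
    finally show ?thesis by (simp add: F_def a_def tan_coord_def)
  qed
  have diff: "field_components M a Z differentiable (at (snd a p))" if "smooth_vf_on M U Z" for Z
    by (rule smooth_vf_on_components_differentiable[OF that a U(2)])
  have val: "field_components M a Z (snd a p) = Z p" for Z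
    using components_at_chart[OF a, of Z] tan_coord_chart_at[OF p] by (simp add: a_def)
  have "tan_coord M c p (lie_bracket M X Y p) =
      frechet_derivative F (at (snd a p))
        (frechet_derivative (field_components M a Y) (at (snd a p)) (field_components M a X (snd a p)) -
         frechet_derivative (field_components M a X) (at (snd a p)) (field_components M a Y (snd a p)))"
    unfolding val by (simp add: lie_bracket_def vf_deriv_def tan_coord_def F_def a_def)
  also have "\<dots> = frechet_derivative (field_components M c Y) (at (snd c p)) (tan_coord M c p (X p)) -
      frechet_derivative (field_components M c X) (at (snd c p)) (tan_coord M c p (Y p))"
    using bracket_of_pushforward[OF S F diff[OF X] diff[OF Y]] by (simp only: push[OF X] push[OF Y] val)
  finally show ?thesis .
qed

lemma smooth_vf_on_lie_bracket:
  assumes U: "openin (mtop M) U" and X: "smooth_vf_on M U X" and Y: "smooth_vf_on M U Y"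
  shows "smooth_vf_on M U (lie_bracket M X Y)"
  unfolding smooth_vf_on_def
proof
  fix c assume c: "c \<in> atlas M"
  let ?S = "snd c ` (fst c \<inter> U)"
  have S: "open ?S" using open_chart_image[OF c U] .
  have "smooth_on ?S (\<lambda>y. frechet_derivative (field_components M c Y) (at y) (field_components M c X y) -
      frechet_derivative (field_components M c X) (at y) (field_components M c Y y))"
    by (intro smooth_on_diff smooth_on_frechet_derivative_field S smooth_vf_on_components X Y c)
  moreover have "field_components M c (lie_bracket M X Y) y =
      frechet_derivative (field_components M c Y) (at y) (field_components M c X y) -
      frechet_derivative (field_components M c X) (at y) (field_components M c Y y)" if "y \<in> ?S" for y
    using that tan_coord_lie_bracket[OF U _ c _ X Y] c by (auto simp: chart_inv_left)
  ultimately show "smooth_on ?S (field_components M c (lie_bracket M X Y))"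
    by (rule smooth_on_transform[OF S])
qed

text \<open>Constant components have zero derivative. Through torsion-freeness this becomes the
  symmetry of the Christoffel symbols.\<close>

lemma lie_bracket_coord_field:
  assumes p: "p \<in> points M" and b: "b = chart_at M p"
  shows "lie_bracket M (coord_field M b u) (coord_field M b v) p = 0"
proof -
  note b' = chart_at[OF p, folded b]
  show ?thesis
    by (simp add: lie_bracket_def vf_deriv_def b[symmetric] frechet_derivative_components_coord_field[OF b'])
qed

end

section \<open>Affine connections in coordinates\<close>

context affine_connection
begin

lemma nabla_combination:
  assumes U: "openin (mtop M) U" "p \<in> U" and X: "smooth_vf_on M U X" and "finite A"
    and "\<And>i. i \<in> A \<Longrightarrow> smooth_fun_on M U (h i)" "\<And>i. i \<in> A \<Longrightarrow> smooth_vf_on M U (E i)"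
  shows "nabla X (\<lambda>x. \<Sum>i\<in>A. h i x *\<^sub>R E i x) p =
    (\<Sum>i\<in>A. vf_deriv M X (h i) p *\<^sub>R E i p + h i p *\<^sub>R nabla X (E i) p)"
  using assms(4-6)
proof (induction A rule: finite_induct)
  case empty
  \<comment> \<open>The empty sum is treated as 0 times \<open>X\<close>, and the Leibniz rule makes
    its derivative zero.\<close>
  show ?case
    using connection_leibniz[OF U(1) smooth_fun_on_const X X U(2), of 0]
    by (simp add: vf_deriv_def o_def)
next
  case (insert i A)
  then show ?case
    using connection_add_right[OF U(1) X _ smooth_vf_on_combination[OF U(1)] U(2),
        of "\<lambda>x. h i x *\<^sub>R E i x" A h E]
    by (simp add: smooth_vf_on_scale[OF U(1)] connection_leibniz[OF U(1) _ X _ U(2)])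
qed

text \<open>Splits off the derivative of the components of \<open>Y\<close>, leaving a Christoffel
  term that sees only \<open>Y p\<close>. This is the ambient counterpart of the formula that
  defines \<open>cov_along\<close>.\<close>

lemma nabla_coord_field_expand:
  assumes p: "p \<in> points M" and b: "b = chart_at M p" and Y: "smooth_vf_on M (fst b) Y"
  shows "nabla (coord_field M b u) Y p =
    frechet_derivative (field_components M b Y) (at (snd b p)) u +
    nabla (coord_field M b u) (coord_field M b (Y p)) p"
proof -
  note b' = chart_at[OF p, folded b]
  have expand: "nabla (coord_field M b u) Z p = frechet_derivative (field_components M b Z) (at (snd b p)) u +
      (\<Sum>i\<in>Basis. (Z p \<bullet> i) *\<^sub>R nabla (coord_field M b u) (coord_field M b i) p)"
    if Z: "smooth_vf_on M (fst b) Z" for Z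
  proof -
    let ?h = "\<lambda>i x. tan_coord M b x (Z x) \<bullet> i"
    have deriv: "vf_deriv M (coord_field M b u) (?h i) p =
        frechet_derivative (field_components M b Z) (at (snd b p)) u \<bullet> i" for i
    proof -
      have "((\<lambda>y. field_components M b Z y \<bullet> i) has_derivative
          (\<lambda>v. frechet_derivative (field_components M b Z) (at (snd b p)) v \<bullet> i)) (at (snd b p))"
        by (intro bounded_linear.has_derivative[OF bounded_linear_inner_left] has_derivative_frechet
            smooth_vf_on_components_differentiable[OF Z b' b'(2)])
      from frechet_derivative_eqI[OF this] show ?thesis
        by (simp add: vf_deriv_def b[symmetric] o_def coord_field_chart_at[OF p, folded b])
    qed
    \<comment> \<open>The expansion of \<open>Z\<close> in coordinate fields holds on the domain of
      \<open>b\<close> only, hence the appeal to locality.\<close>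
    have "nabla (coord_field M b u) Z p =
        nabla (coord_field M b u) (\<lambda>x. \<Sum>i\<in>Basis. ?h i x *\<^sub>R coord_field M b i x) p"
      by (rule connection_local[OF chart_open[OF b'(1)] smooth_vf_on_coord_field[OF b'(1)]
            smooth_vf_on_combination[OF chart_open[OF b'(1)]] _ _ b'(2)])
        (simp_all add: smooth_fun_on_component[OF b'(1) Z] smooth_vf_on_coord_field[OF b'(1)]
          flip: vf_expand_coord_field[OF b'(1)])
    also have "\<dots> = (\<Sum>i\<in>Basis. vf_deriv M (coord_field M b u) (?h i) p *\<^sub>R coord_field M b i p +
        ?h i p *\<^sub>R nabla (coord_field M b u) (coord_field M b i) p)"
      by (intro nabla_combination[OF chart_open[OF b'(1)] b'(2)] smooth_vf_on_coord_field[OF b'(1)]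
          smooth_fun_on_component[OF b'(1) Z] finite_Basis)
    also have "\<dots> = frechet_derivative (field_components M b Z) (at (snd b p)) u +
        (\<Sum>i\<in>Basis. (Z p \<bullet> i) *\<^sub>R nabla (coord_field M b u) (coord_field M b i) p)"
      by (simp add: deriv sum.distrib coord_field_chart_at[OF p, folded b]
          tan_coord_chart_at[OF p, folded b] euclidean_representation)
    finally show ?thesis .
  qed
  \<comment> \<open>The field with constant components \<open>Y p\<close> has the same sum as
    \<open>Y\<close> and no derivative term, so it evaluates the sum.\<close>
  show ?thesis
    using expand[OF Y] expand[OF smooth_vf_on_coord_field[OF b'(1)], of "Y p"]
    by (simp add: coord_field_chart_at[OF p, folded b] frechet_derivative_components_coord_field[OF b'])
qed

end

section \<open>The covariant derivative along an immersion\<close>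

context immersed_submanifold
begin

lemma image_in_points: "p \<in> points M \<Longrightarrow> f p \<in> points Mb"
  using immersion_continuous continuous_map_image_subset_topspace by blast

lemma open_preimage_chart:
  assumes "c \<in> atlas M" "b \<in> atlas Mb"
  shows "open (snd c ` (fst c \<inter> f -` fst b))"
proof -
  have "openin (mtop M) {x \<in> points M. f x \<in> fst b}"
    by (rule openin_continuous_map_preimage[OF immersion_continuous Mb.chart_open[OF assms(2)]])
  moreover have "fst c \<inter> {x \<in> points M. f x \<in> fst b} = fst c \<inter> f -` fst b"
    using M.chart_subset[OF assms(1)] by auto
  ultimately show ?thesis using M.open_chart_image[OF assms(1)] by metis
qed

lemma immersion_differentiable:
  assumes "c \<in> atlas M" "b \<in> atlas Mb" "p \<in> fst c" "f p \<in> fst b"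
  shows "(snd b \<circ> f \<circ> chart_inv c) differentiable (at (snd c p))"
  using smooth_on_differentiable[OF immersion_smooth[OF assms(1,2)]] assms by blast

lemma linear_differential:
  assumes "p \<in> points M"
  shows "linear (differential Mb M f p)"
  unfolding differential_def
  by (intro linear_frechet_derivative immersion_differentiable M.chart_at Mb.chart_at
      image_in_points assms)

text \<open>\<open>differential\<close> is written in the preferred charts at \<open>p\<close> and
  \<open>f p\<close>, and both may jump as the point moves. Differentiating a pushed forward field
  needs the formula in a fixed pair of charts.\<close>

lemma tan_coord_differential:
  assumes c: "c \<in> atlas M" "p \<in> fst c" and b: "b \<in> atlas Mb" "f p \<in> fst b"
  shows "tan_coord Mb b (f p) (differential Mb M f p v) =
    frechet_derivative (snd b \<circ> f \<circ> chart_inv c) (at (snd c p)) (tan_coord M c p v)"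
proof -
  have p: "p \<in> points M" using c M.chart_subset by blast
  define a where "a = chart_at M p"
  note a = M.chart_at[OF p, folded a_def]
  define e where "e = chart_at Mb (f p)"
  note e = Mb.chart_at[OF image_in_points[OF p], folded e_def]
  let ?S = "snd a ` (fst a \<inter> f -` fst e)"
  let ?F = "snd e \<circ> f \<circ> chart_inv a"
  have S: "open (?S \<inter> snd a ` (fst a \<inter> f -` fst b))" "snd a p \<in> ?S \<inter> snd a ` (fst a \<inter> f -` fst b)"
    using open_Int[OF open_preimage_chart[OF a(1) e(1)] open_preimage_chart[OF a(1) b(1)]] a e b by auto
  have eq: "(snd b \<circ> f \<circ> chart_inv a) y = (snd b \<circ> chart_inv e) (?F y)"
    if "y \<in> ?S \<inter> snd a ` (fst a \<inter> f -` fst b)" for y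
  proof -
    from that have "y \<in> ?S" by blast
    then have "chart_inv a y \<in> f -` fst e"
      using M.chart_inv_left[OF a(1)] by auto
    then show ?thesis using e by (simp add: Mb.chart_inv_left)
  qed
  have Fp: "?F (snd a p) = snd e (f p)" using a by (simp add: M.chart_inv_left)
  have "tan_coord Mb b (f p) (differential Mb M f p v) =
      frechet_derivative (snd b \<circ> chart_inv e) (at (?F (snd a p))) (frechet_derivative ?F (at (snd a p)) v)"
    unfolding Fp by (simp add: tan_coord_def differential_def a_def e_def)
  also have "\<dots> = frechet_derivative (\<lambda>y. (snd b \<circ> chart_inv e) (?F y)) (at (snd a p)) v"
    by (intro frechet_derivative_chain(1)[symmetric] immersion_differentiable a e)
      (simp only: Fp Mb.transition_differentiable[OF e(1) b(1) e(2) b(2)])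
  also have "frechet_derivative (\<lambda>y. (snd b \<circ> chart_inv e) (?F y)) (at (snd a p)) =
      frechet_derivative (snd b \<circ> f \<circ> chart_inv a) (at (snd a p))"
    by (rule frechet_derivative_cong_open[OF S eq[symmetric]])
  also have "\<dots> v = frechet_derivative (snd b \<circ> f \<circ> chart_inv c) (at (snd c p)) (tan_coord M c p v)"
    unfolding tan_coord_def a_def[symmetric]
    by (rule M.change_chart(1)[OF a(1) c(1) a(2) c(2) immersion_differentiable[OF c(1) b(1) c(2) b(2)]])
  finally show ?thesis .
qed

lemma pushforward_in_chart:
  assumes a: "a \<in> atlas M" and b: "b \<in> atlas Mb" and y: "y \<in> snd a ` (fst a \<inter> f -` fst b)"
  shows "((\<lambda>x. tan_coord Mb b (f x) (differential Mb M f x (Y x))) \<circ> chart_inv a) y =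
    frechet_derivative (snd b \<circ> f \<circ> chart_inv a) (at y) (field_components M a Y y)"
  using y tan_coord_differential[OF a _ b] a by (auto simp: M.chart_inv_left)

text \<open>Supplies the differentiability hypothesis of \<open>cov_along_J\<close> for pushed
  forward fields.\<close>

lemma pushforward_differentiable:
  assumes a: "a \<in> atlas M" "p \<in> fst a" and b: "b \<in> atlas Mb" "f p \<in> fst b"
    and Y: "smooth_vf_on M (points M) Y"
  shows "((\<lambda>x. tan_coord Mb b (f x) (differential Mb M f x (Y x))) \<circ> chart_inv a) differentiable (at (snd a p))"
proof -
  have S: "open (snd a ` (fst a \<inter> f -` fst b))" "snd a p \<in> snd a ` (fst a \<inter> f -` fst b)"
    using open_preimage_chart a b by auto
  have "field_components M a Y differentiable (at (snd a p))"
    using M.smooth_vf_on_components_differentiable[OF Y a] M.chart_subset[OF a(1)] a(2) by blast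
  note d = frechet_derivative_of_pushforward(1)[OF S immersion_smooth[OF a(1) b(1)] this]
  show ?thesis by (rule differentiable_cong_open[OF S pushforward_in_chart[OF a(1) b(1)] d])
qed

end

locale kaehler_immersion =
  indefinite_kaehler_manifold Mb q g nabla J + immersed_submanifold Mb M f
  for Mb :: "('a, 'e::euclidean_space) manifold" and q g nabla J
    and M :: "('b, 'd::euclidean_space) manifold" and f
begin

text \<open>The two summands of \<open>cov_along\<close> are antisymmetrized separately: the
  derivatives of components give the bracket by \<open>bracket_of_pushforward\<close> for
  \<open>F\<close>, the coordinate expression of \<open>f\<close>, and the Christoffel terms cancel
  because coordinate fields commute.\<close>

lemma cov_along_torsion_free:
  assumes p: "p \<in> points M"
    and X: "smooth_vf_on M (points M) X" and Y: "smooth_vf_on M (points M) Y"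
  shows "cov_along Mb nabla M f X (\<lambda>x. differential Mb M f x (Y x)) p -
      cov_along Mb nabla M f Y (\<lambda>x. differential Mb M f x (X x)) p =
    differential Mb M f p (lie_bracket M X Y p)"
proof -
  define a where "a = chart_at M p"
  note a = M.chart_at[OF p, folded a_def]
  define b where "b = chart_at Mb (f p)"
  note fp = image_in_points[OF p]
  note b = chart_at[OF fp, folded b_def]
  define F where "F = snd b \<circ> f \<circ> chart_inv a"
  let ?S = "snd a ` (fst a \<inter> f -` fst b)"
  have S: "open ?S" "snd a p \<in> ?S" using open_preimage_chart a b by auto
  have push: "vf_deriv M Z (\<lambda>x. tan_coord Mb b (f x) (differential Mb M f x (W x))) p =
      frechet_derivative (\<lambda>y. frechet_derivative F (at y) (field_components M a W y)) (at (snd a p)) (Z p)" for Z W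
    unfolding vf_deriv_def a_def[symmetric] F_def
    by (rule fun_cong[OF frechet_derivative_cong_open[OF S pushforward_in_chart[OF a(1) b(1)]]])
  have diff: "field_components M a Z differentiable (at (snd a p))" if "smooth_vf_on M (points M) Z" for Z
    by (rule M.smooth_vf_on_components_differentiable[OF that a p])
  have val: "field_components M a Z (snd a p) = Z p" for Z
    using M.components_at_chart[OF a, of Z] M.tan_coord_chart_at[OF p] by (simp add: a_def)
  have "nabla (coord_field Mb b u) (coord_field Mb b v) (f p) -
      nabla (coord_field Mb b v) (coord_field Mb b u) (f p) = 0" for u v
    using torsion_free[OF chart_open[OF b(1)] smooth_vf_on_coord_field[OF b(1)]
        smooth_vf_on_coord_field[OF b(1)] b(2)]
      lie_bracket_coord_field[OF fp b_def] by simp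
  then have "cov_along Mb nabla M f X (\<lambda>x. differential Mb M f x (Y x)) p -
      cov_along Mb nabla M f Y (\<lambda>x. differential Mb M f x (X x)) p =
    frechet_derivative (\<lambda>y. frechet_derivative F (at y) (field_components M a Y y)) (at (snd a p)) (field_components M a X (snd a p)) -
    frechet_derivative (\<lambda>y. frechet_derivative F (at y) (field_components M a X y)) (at (snd a p)) (field_components M a Y (snd a p))"
    unfolding val by (simp add: cov_along_def Let_def b_def[symmetric] push)
  also have "\<dots> = frechet_derivative F (at (snd a p))
      (frechet_derivative (field_components M a Y) (at (snd a p)) (X p) -
       frechet_derivative (field_components M a X) (at (snd a p)) (Y p))"
    using bracket_of_pushforward[OF S _ diff[OF X] diff[OF Y], of F] immersion_smooth[OF a(1) b(1)]
    by (simp only: val F_def)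
  also have "\<dots> = differential Mb M f p (lie_bracket M X Y p)"
    by (simp add: differential_def lie_bracket_def vf_deriv_def F_def a_def b_def)
  finally show ?thesis .
qed

text \<open>In coordinates the components of \<open>J V\<close> are \<open>W\<^sup>i K\<^sub>i\<close>, where \<open>K\<^sub>i\<close> are the components of \<open>J \<partial>\<^sub>i\<close>.
  The derivatives of the \<open>K\<^sub>i\<close> cancel against the ones in \<open>J (nabla \<partial>\<^sub>i) = nabla (J \<partial>\<^sub>i)\<close>.\<close>

lemma cov_along_J:
  assumes p: "p \<in> points M" and a: "a = chart_at M p" and b: "b = chart_at Mb (f p)"
    and V: "((\<lambda>x. tan_coord Mb b (f x) (V x)) \<circ> chart_inv a) differentiable (at (snd a p))"
  shows "cov_along Mb nabla M f X (\<lambda>x. J (f x) (V x)) p = J (f p) (cov_along Mb nabla M f X V p)"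
proof -
  note a' = M.chart_at[OF p, folded a]
  note fp = image_in_points[OF p]
  note b' = chart_at[OF fp, folded b]
  define F where "F = snd b \<circ> f \<circ> chart_inv a"
  define W where "W = (\<lambda>x. tan_coord Mb b (f x) (V x)) \<circ> chart_inv a"
  define K where "K w = field_components Mb b (\<lambda>q. J q (coord_field Mb b w q))" for w
  let ?S = "snd a ` (fst a \<inter> f -` fst b)"
  have S: "open ?S" "snd a p \<in> ?S" using open_preimage_chart a' b' by auto
  have Fp: "F (snd a p) = snd b (f p)" using a' by (simp add: F_def M.chart_inv_left)
  have Wp: "W (snd a p) = V p" using a' tan_coord_chart_at[OF fp] by (simp add: W_def M.chart_inv_left b)
  have J_smooth': "smooth_vf_on Mb (fst b) (\<lambda>q. J q (coord_field Mb b w q))" for w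
    by (rule J_smooth[OF b'(1)])
  have linJ: "linear (\<lambda>w. tan_coord Mb b q (J q (coord_field Mb b w q)))" if "q \<in> fst b" for q
    using linear_compose[OF linear_compose[OF linear_coord_field[OF b'(1) that] J_linear[of q]]
        linear_tan_coord[OF b'(1) that]] that chart_subset[OF b'(1)] by (auto simp: o_def)
  have K: "K w z = (\<Sum>i\<in>Basis. (w \<bullet> i) *\<^sub>R K i z)" if "z \<in> snd b ` fst b" for w z
  proof -
    from that obtain q where q: "q \<in> fst b" "z = snd b q" by blast
    then show ?thesis
      using linear_euclidean_expand[OF linJ[OF q(1)], of w] by (simp add: K_def chart_inv_left[OF b'(1)])
  qed
  have Kd: "K w differentiable (at (snd b (f p)))" for w
    unfolding K_def by (rule smooth_vf_on_components_differentiable[OF J_smooth' b' b'(2)])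
  have Kp: "K w (snd b (f p)) = J (f p) w" for w
    by (simp add: K_def chart_inv_left[OF b'] tan_coord_chart_at[OF fp, folded b]
        coord_field_chart_at[OF fp, folded b])
  have eq: "((\<lambda>x. tan_coord Mb b (f x) (J (f x) (V x))) \<circ> chart_inv a) y =
      (\<Sum>i\<in>Basis. (W y \<bullet> i) *\<^sub>R K i (F y))" if "y \<in> ?S" for y
  proof -
    from that obtain x where x: "x \<in> fst a" "f x \<in> fst b" and y: "y = snd a x" by blast
    have "((\<lambda>x. tan_coord Mb b (f x) (J (f x) (V x))) \<circ> chart_inv a) y = K (W y) (F y)"
      using x by (simp add: y K_def W_def F_def M.chart_inv_left[OF a'(1)] chart_inv_left[OF b'(1)]
          coord_field_tan_coord[OF b'(1)])
    also have "\<dots> = (\<Sum>i\<in>Basis. (W y \<bullet> i) *\<^sub>R K i (F y))"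
      using x by (intro K) (simp add: F_def y M.chart_inv_left[OF a'(1)])
    finally show ?thesis .
  qed
  have F': "(F has_derivative differential Mb M f p) (at (snd a p))"
    using has_derivative_frechet[OF immersion_differentiable[OF a'(1) b'(1) a'(2) b'(2)]]
    unfolding F_def differential_def a b by simp
  have W': "(W has_derivative frechet_derivative W (at (snd a p))) (at (snd a p))"
    using has_derivative_frechet[OF V] by (simp add: W_def)
  have K': "((\<lambda>y. K i (F y)) has_derivative
      (\<lambda>v. frechet_derivative (K i) (at (snd b (f p))) (differential Mb M f p v))) (at (snd a p))" for i
    using has_derivative_compose[OF F', of "K i"] has_derivative_frechet[OF Kd] Fp by simp
  have "((\<lambda>y. \<Sum>i\<in>Basis. (W y \<bullet> i) *\<^sub>R K i (F y)) has_derivative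
      (\<lambda>v. \<Sum>i\<in>Basis. (W (snd a p) \<bullet> i) *\<^sub>R
          frechet_derivative (K i) (at (snd b (f p))) (differential Mb M f p v) +
        (frechet_derivative W (at (snd a p)) v \<bullet> i) *\<^sub>R K i (F (snd a p)))) (at (snd a p))"
    by (intro has_derivative_sum has_derivative_scaleR K'
        bounded_linear.has_derivative[OF bounded_linear_inner_left W'])
  note dsum = frechet_derivative_eqI[OF this]
  have dcong: "frechet_derivative ((\<lambda>x. tan_coord Mb b (f x) (J (f x) (V x))) \<circ> chart_inv a) (at (snd a p)) =
      frechet_derivative (\<lambda>y. \<Sum>i\<in>Basis. (W y \<bullet> i) *\<^sub>R K i (F y)) (at (snd a p))"
    by (rule frechet_derivative_cong_open[OF S eq])
  have Jsum: "(\<Sum>i\<in>Basis. (v \<bullet> i) *\<^sub>R K i (F (snd a p))) = J (f p) v" for v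
    using linear_euclidean_expand[OF J_linear[OF fp], of v] by (simp add: Fp Kp)
  \<comment> \<open>\<open>K w\<close> is linear in \<open>w\<close>, so the part of the product
    rule with \<open>W\<close> frozen at \<open>V p\<close> is the derivative of the single function
    \<open>K (V p)\<close>.\<close>
  have Ksum: "frechet_derivative (K v) (at (snd b (f p))) u =
      (\<Sum>i\<in>Basis. (v \<bullet> i) *\<^sub>R frechet_derivative (K i) (at (snd b (f p))) u)" for v u
  proof -
    have "((\<lambda>z. \<Sum>i\<in>Basis. (v \<bullet> i) *\<^sub>R K i z) has_derivative
        (\<lambda>u. \<Sum>i\<in>Basis. (v \<bullet> i) *\<^sub>R frechet_derivative (K i) (at (snd b (f p))) u)) (at (snd b (f p)))"
      by (intro has_derivative_sum has_derivative_scaleR_right has_derivative_frechet Kd)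
    moreover have "frechet_derivative (K v) (at (snd b (f p))) =
        frechet_derivative (\<lambda>z. \<Sum>i\<in>Basis. (v \<bullet> i) *\<^sub>R K i z) (at (snd b (f p)))"
      using b'(2) by (intro frechet_derivative_cong_open[OF chart_image_open[OF b'(1)]] K) auto
    ultimately show ?thesis by (simp only: frechet_derivative_eqI)
  qed
  have deriv: "vf_deriv M X (\<lambda>x. tan_coord Mb b (f x) (J (f x) (V x))) p =
      frechet_derivative (K (V p)) (at (snd b (f p))) (differential Mb M f p (X p)) +
      J (f p) (vf_deriv M X (\<lambda>x. tan_coord Mb b (f x) (V x)) p)"
    by (simp only: vf_deriv_def a[symmetric] dcong dsum sum.distrib Wp Jsum W_def[symmetric]
        Ksum[of "V p" "differential Mb M f p (X p)"])
  let ?C = "coord_field Mb b (differential Mb M f p (X p))"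
  have "J (f p) (nabla ?C (coord_field Mb b (V p)) (f p)) =
      nabla ?C (\<lambda>q. J q (coord_field Mb b (V p) q)) (f p)"
    using J_parallel[OF chart_open[OF b'(1)] smooth_vf_on_coord_field[OF b'(1)]
        smooth_vf_on_coord_field[OF b'(1)] b'(2)] by simp
  \<comment> \<open>\<open>J\<close> applied to a field with constant components has components
    \<open>K (V p)\<close>, which vary; their derivative is the extra term in
    \<open>deriv\<close>.\<close>
  also have "\<dots> = frechet_derivative (K (V p)) (at (snd b (f p))) (differential Mb M f p (X p)) +
      nabla ?C (coord_field Mb b (J (f p) (V p))) (f p)"
    using nabla_coord_field_expand[OF fp b J_smooth'] coord_field_chart_at[OF fp]
    by (simp add: K_def b)
  finally show ?thesis
    by (simp add: cov_along_def Let_def b[symmetric] deriv linear_add[OF J_linear[OF fp]])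
qed

end

section \<open>The transversal splitting\<close>

lemma subspace_set_plus: "subspace A \<Longrightarrow> subspace B \<Longrightarrow> subspace (A + B)"
proof -
  assume "subspace A" "subspace B"
  moreover have "A + B = {x + y |x y. x \<in> A \<and> y \<in> B}" by (auto simp: set_plus_def)
  ultimately show ?thesis using subspace_sums by simp
qed

lemma dim_set_plus:
  assumes "subspace A" "subspace B" "A \<inter> B = {0}"
  shows "dim (A + B) = dim A + dim (B :: 'a::euclidean_space set)"
proof -
  have "A + B = {x + y |x y. x \<in> A \<and> y \<in> B}" by (auto simp: set_plus_def)
  then show ?thesis using dim_sums_Int[OF assms(1,2)] assms(3) by simp
qed

text \<open>\<open>T\<close> represents \<open>B\<close> through the inner product and is bijective
  by nondegeneracy; \<open>orth B W\<close> is the preimage under \<open>T\<close> of the Euclidean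
  complement of \<open>W\<close>. Thus the dimensions add up even when \<open>W\<close> meets
  \<open>orth B W\<close>.\<close>

lemma dim_orth:
  fixes B :: "'e::euclidean_space \<Rightarrow> 'e \<Rightarrow> real"
  assumes B: "bilinear B" "nondegenerate_on B UNIV" and W: "subspace W"
  shows "dim (orth B W) + dim W = DIM('e)"
proof -
  define T where "T v = (\<Sum>i\<in>Basis. B v i *\<^sub>R i)" for v
  have T: "B v w = T v \<bullet> w" for v w
  proof -
    have "B v w = (\<Sum>i\<in>Basis. (w \<bullet> i) *\<^sub>R B v i)"
      using B(1) by (intro linear_euclidean_expand) (simp add: bilinear_def)
    then show ?thesis by (simp add: T_def inner_sum_left inner_commute[of w] mult.commute)
  qed
  have lin: "linear T"
    by (rule linearI) (simp_all add: T_def bilinear_ladd[OF B(1)] bilinear_lmul[OF B(1)]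
        scaleR_add_left sum.distrib scaleR_sum_right)
  have "v = 0" if "T v = 0" for v
    using B(2) that by (simp add: nondegenerate_on_def T)
  then have inj: "inj T" using lin by (simp add: linear_injective_0)
  then have surj: "surj T" using linear_injective_imp_surjective[OF lin] by blast
  let ?Z = "{y \<in> UNIV. \<forall>x\<in>W. orthogonal x y}"
  have "orth B W = T -` ?Z"
    by (auto simp: orth_def T orthogonal_def inner_commute)
  then have "T ` orth B W = ?Z" by (simp only: surj_image_vimage_eq[OF surj])
  then have "dim (orth B W) = dim ?Z"
    using dim_image_eq[OF lin, of "orth B W"] inj by (metis inj_on_subset subset_UNIV)
  then show ?thesis
    using dim_subspace_orthogonal_to_vectors[OF W subspace_UNIV subset_UNIV] by simp
qed

lemma subbundle_subspace:
  assumes "subbundle Mb M f E" "p \<in> points M"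
  shows "subspace (E p)"
  using assms unfolding subbundle_def smooth_frame_def by (metis subspace_span)

section \<open>The fibres of a lightlike submanifold\<close>

context lightlike_submanifold
begin

lemma subspace_tangent_bundle: "p \<in> points M \<Longrightarrow> subspace (tangent_bundle Mb M f p)"
  unfolding tangent_bundle_def using linear_differential linear_subspace_image subspace_UNIV by blast

lemma subspace_normal_bundle:
  assumes "p \<in> points M"
  shows "subspace (normal_bundle Mb g M f p)"
  using metric_bilinear[OF image_in_points[OF assms]]
  unfolding normal_bundle_def orth_def subspace_def
  by (auto simp: bilinear_lzero bilinear_ladd bilinear_lmul)

lemma subspace_radical: "p \<in> points M \<Longrightarrow> subspace (radical Mb g M f p)"
  unfolding radical_def by (intro subspace_inter subspace_tangent_bundle subspace_normal_bundle)

lemma subspace_transversal_bundle: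
  assumes "p \<in> points M"
  shows "subspace (transversal_bundle ltr STMperp p)"
  unfolding transversal_bundle_def
  by (intro subspace_set_plus subbundle_subspace[OF ltr_subbundle assms]
      subbundle_subspace[OF screen_transversal_subbundle assms])

lemma transversal_summands_subset:
  assumes "p \<in> points M"
  shows "ltr p \<subseteq> transversal_bundle ltr STMperp p" "STMperp p \<subseteq> transversal_bundle ltr STMperp p"
  unfolding transversal_bundle_def
  using set_zero_plus2[OF subspace_0[OF subbundle_subspace[OF ltr_subbundle assms]]]
    set_zero_plus2[OF subspace_0[OF subbundle_subspace[OF screen_transversal_subbundle assms]]]
  by (metis add.commute)+

lemma screen_transversal_subset_normal:
  assumes "p \<in> points M"
  shows "STMperp p \<subseteq> normal_bundle Mb g M f p"
  using screen_transversal_sum[OF assms] set_zero_plus2[OF subspace_0[OF subspace_radical[OF assms]]]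
  unfolding orth_direct_sum_def direct_sum_def by (metis add.commute)

text \<open>Pairing with the frame of the radical that is dual to the frame of \<open>ltr\<close>
  reads off the coefficients of \<open>l\<close>.\<close>

lemma ltr_inter_radical_orth:
  assumes p: "p \<in> points M" and l: "l \<in> ltr p" and 0: "\<And>v. v \<in> radical Mb g M f p \<Longrightarrow> g (f p) v l = 0"
  shows "l = 0"
proof -
  have bil: "bilinear (g (f p))" using metric_bilinear[OF image_in_points[OF p]] .
  obtain U \<xi> N where "p \<in> U" and \<xi>: "smooth_frame Mb M f U r \<xi> (radical Mb g M f)"
    and N: "smooth_frame Mb M f U r N ltr"
    and dual: "\<And>i j. i < r \<Longrightarrow> j < r \<Longrightarrow> g (f p) (\<xi> i p) (N j p) = (if i = j then 1 else 0)"
    using ltr_frame[OF p] by blast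
  have rad: "\<xi> i p \<in> radical Mb g M f p" if "i < r" for i
  proof -
    have "radical Mb g M f p = span ((\<lambda>i. \<xi> i p) ` {..<r})"
      using \<xi> \<open>p \<in> U\<close> unfolding smooth_frame_def by blast
    then show ?thesis using that by (simp add: span_base)
  qed
  have "l \<in> span ((\<lambda>i. N i p) ` {..<r})"
    using N \<open>p \<in> U\<close> l unfolding smooth_frame_def by simp
  \<comment> \<open>Duality separates the frame vectors, so a combination over the set of their
    values can be reindexed by \<open>j < r\<close>.\<close>
  moreover have "inj_on (\<lambda>i. N i p) {..<r}"
  proof (rule inj_onI)
    fix i j assume ij: "i \<in> {..<r}" "j \<in> {..<r}" "N i p = N j p"
    show "i = j" using dual[of i i] dual[of i j] ij by (auto split: if_splits)
  qed
  ultimately obtain k where k: "l = (\<Sum>j<r. k (N j p) *\<^sub>R N j p)"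
    by (auto simp: span_finite sum.reindex)
  have "k (N i p) = 0" if i: "i < r" for i
  proof -
    have "g (f p) (\<xi> i p) l = (\<Sum>j<r. k (N j p) * g (f p) (\<xi> i p) (N j p))"
      using bil by (subst k) (simp add: bilinear_def linear_sum linear_scale)
    also have "\<dots> = (\<Sum>j<r. if j = i then k (N j p) else 0)"
      by (intro sum.cong refl) (use i in \<open>auto simp: dual\<close>)
    also have "\<dots> = k (N i p)" using i by simp
    finally show ?thesis using 0[OF rad[OF i]] by simp
  qed
  then show ?thesis by (simp add: k)
qed

text \<open>For a tangent \<open>v = l + s\<close>, pairing with the radical kills \<open>v\<close>,
  since the radical is normal, and \<open>s\<close>, since the radical is tangent; hence
  \<open>l = 0\<close> by duality. What remains lies in \<open>STMperp\<close> and in the radical,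
  which meet trivially.\<close>

lemma tangent_inter_transversal:
  assumes p: "p \<in> points M"
  shows "tangent_bundle Mb M f p \<inter> transversal_bundle ltr STMperp p = {0}"
proof -
  have bil: "bilinear (g (f p))" using metric_bilinear[OF image_in_points[OF p]] .
  have "v = 0" if v: "v \<in> tangent_bundle Mb M f p" "v \<in> transversal_bundle ltr STMperp p" for v
  proof -
    from v(2) obtain l s where l: "l \<in> ltr p" and s: "s \<in> STMperp p" and vls: "v = l + s"
      unfolding transversal_bundle_def by (auto elim: set_plus_elim)
    have sn: "s \<in> normal_bundle Mb g M f p" using s screen_transversal_subset_normal[OF p] by blast
    have "g (f p) w l = 0" if w: "w \<in> radical Mb g M f p" for w
    proof -
      have "g (f p) w v = 0" "g (f p) s w = 0"
        using w v(1) sn unfolding radical_def normal_bundle_def orth_def by auto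
      then show ?thesis
        using metric_symmetric[OF image_in_points[OF p]] by (simp add: vls bilinear_radd[OF bil])
    qed
    then have "l = 0" by (rule ltr_inter_radical_orth[OF p l])
    then have "v \<in> STMperp p \<inter> radical Mb g M f p"
      using v(1) s sn vls by (simp add: radical_def)
    then show ?thesis
      using screen_transversal_sum[OF p] unfolding orth_direct_sum_def direct_sum_def by blast
  qed
  then show ?thesis
    using subspace_0[OF subspace_tangent_bundle[OF p]] subspace_0[OF subspace_transversal_bundle[OF p]] by blast
qed

text \<open>Dimension count: \<open>ltr\<close> and the radical both have dimension
  \<open>r\<close>, so the transversal fibre has the dimension of the normal one, and this is
  complementary to the tangent dimension. The normal fibre itself is no complement, as it meets the
  tangent fibre in the radical.\<close>

lemma tangent_plus_transversal:
  assumes p: "p \<in> points M"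
  shows "tangent_bundle Mb M f p + transversal_bundle ltr STMperp p = UNIV"
proof -
  note fp = image_in_points[OF p]
  note bil = metric_bilinear[OF fp]
  note T = subspace_tangent_bundle[OF p] and R = subspace_radical[OF p]
    and tr = subspace_transversal_bundle[OF p]
    and l = subbundle_subspace[OF ltr_subbundle p]
    and s = subbundle_subspace[OF screen_transversal_subbundle p]
    and S = subbundle_subspace[OF screen_subbundle p]
  \<comment> \<open>\<open>ltr\<close> is orthogonal to \<open>STMperp\<close>, on which the metric
    is nondegenerate.\<close>
  have "v = 0" if v: "v \<in> ltr p" "v \<in> STMperp p" for v
  proof -
    have "v \<in> orth (g (f p)) (STM p + STMperp p)"
      using ltr_complement[OF p] v(1) set_zero_plus2[OF subspace_0[OF R]] unfolding direct_sum_def by blast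
    then have "\<forall>w\<in>STMperp p. g (f p) v w = 0"
      using set_zero_plus2[OF subspace_0[OF S]] unfolding orth_def by blast
    then show ?thesis
      using screen_transversal_nondegenerate[OF p] v(2) unfolding nondegenerate_on_def by blast
  qed
  then have "ltr p \<inter> STMperp p = {0}" using subspace_0[OF l] subspace_0[OF s] by blast
  then have "dim (transversal_bundle ltr STMperp p) = dim (ltr p) + dim (STMperp p)"
    unfolding transversal_bundle_def by (rule dim_set_plus[OF l s])
  moreover have "dim (ltr p) = r"
    using ltr_frame[OF p] unfolding smooth_frame_def by blast
  moreover have "dim (normal_bundle Mb g M f p) = dim (STMperp p) + r"
    using screen_transversal_sum[OF p] dim_set_plus[OF s R] radical_rank[OF p]
    unfolding orth_direct_sum_def direct_sum_def by metis
  moreover have "dim (normal_bundle Mb g M f p) + dim (tangent_bundle Mb M f p) = DIM('e)"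
    unfolding normal_bundle_def by (rule dim_orth[OF bil metric_nondegenerate[OF fp] T])
  ultimately have "dim (tangent_bundle Mb M f p + transversal_bundle ltr STMperp p) = DIM('e)"
    using dim_set_plus[OF T tr tangent_inter_transversal[OF p]] by simp
  then show ?thesis
    using dim_eq_full subspace_set_plus[OF T tr] span_eq_iff by blast
qed

text \<open>Makes the \<open>THE\<close> in \<open>shape_operator\<close> meaningful: the splitting
  determines the tangential part in the ambient fibre, and injectivity of the differential pulls it
  back to \<open>M\<close>.\<close>

lemma tangential_part_unique:
  assumes p: "p \<in> points M"
  shows "\<exists>!w. u + differential Mb M f p w \<in> transversal_bundle ltr STMperp p"
proof -
  note lin = linear_differential[OF p] and tr = subspace_transversal_bundle[OF p]
  have "u \<in> tangent_bundle Mb M f p + transversal_bundle ltr STMperp p"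
    using tangent_plus_transversal[OF p] by simp
  then obtain w t where "u = differential Mb M f p w + t" "t \<in> transversal_bundle ltr STMperp p"
    unfolding tangent_bundle_def by (auto elim!: set_plus_elim)
  then have "u + differential Mb M f p (- w) \<in> transversal_bundle ltr STMperp p"
    by (simp add: linear_neg[OF lin])
  moreover have "w = w'"
    if "u + differential Mb M f p w \<in> transversal_bundle ltr STMperp p"
      "u + differential Mb M f p w' \<in> transversal_bundle ltr STMperp p" for w w'
  proof -
    have "differential Mb M f p (w - w') \<in> transversal_bundle ltr STMperp p"
      using subspace_diff[OF tr that] by (simp add: linear_diff[OF lin])
    then have "differential Mb M f p (w - w') = 0"
      using tangent_inter_transversal[OF p] unfolding tangent_bundle_def by blast
    then have "differential Mb M f p w = differential Mb M f p w'"
      by (simp add: linear_diff[OF lin])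
    then show ?thesis by (rule injD[OF immersion_inj[OF p]])
  qed
  ultimately show ?thesis by blast
qed

lemma shape_operator_transversal:
  "p \<in> points M \<Longrightarrow>
    cov_along Mb nabla M f X V p +
      differential Mb M f p (shape_operator Mb nabla M f (transversal_bundle ltr STMperp) V X p)
    \<in> transversal_bundle ltr STMperp p"
  unfolding shape_operator_def by (rule theI'[OF tangential_part_unique])

end

section \<open>STCR lightlike submanifolds\<close>

sublocale STCR_lightlike_submanifold \<subseteq> kaehler_immersion Mb q g nabla J M f ..

context STCR_lightlike_submanifold
begin

text \<open>The fibres of \<open>D~\<close> and \<open>D\<close> inside the ambient tangent space;
  \<open>D_tilde\<close> is the preimage of \<open>D_anti\<close> under the differential.\<close>

abbreviation "D_anti p \<equiv> D2 p + J (f p) ` L1 p + J (f p) ` S p"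
abbreviation "D_inv p \<equiv> D0 p + D1 p + J (f p) ` D1 p"

lemma subspaces:
  assumes "p \<in> points M"
  shows "subspace (D0 p)" "subspace (D1 p)" "subspace (D2 p)" "subspace (D' p)" "subspace (L1 p)"
    "subspace (L2 p)" "subspace (S p)"
  using subbundle_subspace[OF subbundles(1) assms] subbundle_subspace[OF subbundles(2) assms]
    subbundle_subspace[OF subbundles(3) assms] subbundle_subspace[OF subbundles(4) assms]
    subbundle_subspace[OF subbundles(5) assms] subbundle_subspace[OF subbundles(6) assms]
    subbundle_subspace[OF subbundles(7) assms] by auto

lemma linear_J: "p \<in> points M \<Longrightarrow> linear (J (f p))"
  by (intro J_linear image_in_points)

lemma subspace_J_image: "p \<in> points M \<Longrightarrow> subspace W \<Longrightarrow> subspace (J (f p) ` W)"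
  by (intro linear_subspace_image linear_J)

lemma subspace_D_anti: "p \<in> points M \<Longrightarrow> subspace (D_anti p)"
  by (intro subspace_set_plus subspace_J_image subspaces)

lemma J_J_image:
  assumes "p \<in> points M" "subspace W"
  shows "J (f p) ` J (f p) ` W = W"
  using assms(2) J_square[OF image_in_points[OF assms(1)]]
  by (auto simp: image_iff subspace_neg) (metis minus_minus subspace_neg)

lemma J_image_set_plus:
  "p \<in> points M \<Longrightarrow> J (f p) ` (A + B) = J (f p) ` A + J (f p) ` B"
  by (force simp: set_plus_def image_iff linear_add[OF linear_J])

text \<open>Apply \<open>J\<close> to the given splitting of \<open>J D'\<close>; applying
  \<open>J\<close> twice is negation and maps each subspace onto itself.\<close>

lemma D'_eq:
  assumes p: "p \<in> points M"
  shows "D' p = J (f p) ` L1 p + J (f p) ` S p"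
proof -
  have "J (f p) ` J (f p) ` D' p = J (f p) ` (L1 p + S p)"
    using J_D'[OF p] by (simp add: orth_direct_sum_def direct_sum_def)
  then show ?thesis
    by (simp add: J_J_image[OF p subspaces(4)[OF p]] J_image_set_plus[OF p])
qed

lemma tangent_bundle_eq:
  assumes p: "p \<in> points M"
  shows "tangent_bundle Mb M f p = D_inv p + D_anti p"
proof -
  have "tangent_bundle Mb M f p = (J (f p) ` D1 p + D' p + D0 p) + (D1 p + D2 p)"
    using screen_sum[OF p] screen_decomposition[OF p] radical_sum[OF p]
    unfolding orth_direct_sum_def direct_sum_def by simp
  then show ?thesis by (simp add: D'_eq[OF p] add_ac)
qed

text \<open>The given splittings are used in turn: screen against radical, \<open>D1\<close> against
  \<open>D2\<close>, \<open>J D1 + D'\<close> against \<open>D0\<close>, and \<open>J D1\<close>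
  against \<open>D'\<close>.\<close>

lemma D_inv_inter_D_anti:
  assumes p: "p \<in> points M" and v: "v \<in> D_inv p" "v \<in> D_anti p"
  shows "v = 0"
proof -
  from v(1) obtain a b c where abc: "a \<in> D0 p" "b \<in> D1 p" "c \<in> J (f p) ` D1 p" "v = a + b + c"
    by (auto elim!: set_plus_elim)
  from v(2) obtain d e where de: "d \<in> D2 p" "e \<in> D' p" "v = d + e"
    unfolding add.assoc D'_eq[OF p, symmetric] by (auto elim!: set_plus_elim)
  note sub = subspaces[OF p] subspace_J_image[OF p subspaces(2)[OF p]]
  have R: "D1 p + D2 p = radical Mb g M f p" "D1 p \<inter> D2 p = {0}"
    using radical_sum[OF p] by (simp_all add: direct_sum_def)
  have ST: "STM p = J (f p) ` D1 p + D' p + D0 p" "(J (f p) ` D1 p + D' p) \<inter> D0 p = {0}"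
    using screen_decomposition[OF p] by (simp_all add: orth_direct_sum_def direct_sum_def)
  have T: "STM p \<inter> radical Mb g M f p = {0}"
    using screen_sum[OF p] by (simp add: orth_direct_sum_def direct_sum_def)
  \<comment> \<open>Screen components on the left, radical components on the right.\<close>
  have eq: "c + (- e) + a = (- b) + d" using abc(4) de(3) by (simp add: algebra_simps)
  have "c + (- e) \<in> J (f p) ` D1 p + D' p"
    using abc de sub by (intro set_plus_intro subspace_neg) auto
  moreover have "(- b) + d \<in> radical Mb g M f p"
    unfolding R(1)[symmetric] using abc de sub by (intro set_plus_intro subspace_neg) auto
  ultimately have "(- b) + d = 0"
    using T eq abc(1) unfolding ST(1) by (metis IntI set_plus_intro singletonD)
  then have "d = b" by (simp add: neg_eq_iff_add_eq_0[symmetric])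
  then have "d \<in> D1 p \<inter> D2 p" using abc(2) de(1) by simp
  then have bd: "d = 0" using R(2) by blast
  have "c + (- e) = - a" using eq \<open>- b + d = 0\<close> by (simp add: eq_neg_iff_add_eq_0)
  then have "c + (- e) = 0"
    using ST(2) abc(1) sub(1) \<open>c + (- e) \<in> _\<close> by (metis IntI singletonD subspace_neg)
  then have "e = c" by simp
  then have "e \<in> J (f p) ` D1 p \<inter> D' p" using abc(3) de(2) by simp
  then have "e = 0" using J_D1_D'_direct[OF p] by blast
  with bd de(3) show ?thesis by simp
qed

text \<open>\<open>J\<close> preserves \<open>D0\<close> and interchanges \<open>D1\<close> with
  \<open>J D1\<close>.\<close>

lemma J_D_inv:
  assumes p: "p \<in> points M"
  shows "J (f p) ` D_inv p = D_inv p"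
  by (simp add: J_image_set_plus[OF p] J_D0[OF p] J_J_image[OF p subspaces(2)[OF p]] add_ac)

text \<open>\<open>J\<close> sends \<open>D2\<close> into \<open>STMperp\<close> and takes
  \<open>J L1\<close> and \<open>J S\<close> back to \<open>L1\<close> in \<open>ltr\<close> and
  \<open>S\<close> in \<open>STMperp\<close>.\<close>

lemma J_D_anti:
  assumes p: "p \<in> points M"
  shows "J (f p) ` D_anti p \<subseteq> transversal_bundle ltr STMperp p"
proof -
  note sub = subspaces[OF p] and tr = subspace_transversal_bundle[OF p]
  have eq: "J (f p) ` D_anti p = J (f p) ` D2 p + L1 p + S p"
    using sub by (simp add: J_image_set_plus[OF p] J_J_image[OF p])
  have "L1 p \<subseteq> ltr p"
    using ltr_sum[OF p] set_zero_plus2[OF subspace_0[OF sub(6)]]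
    unfolding direct_sum_def by (metis add.commute)
  moreover have "S p \<subseteq> STMperp p"
    using screen_transversal_decomposition[OF p]
      set_zero_plus2[OF subspace_0[OF subspace_set_plus[OF subspace_J_image[OF p sub(3)]
          subspace_J_image[OF p sub(6)]]]]
    unfolding orth_direct_sum_def direct_sum_def by metis
  ultimately show ?thesis
    unfolding eq using J_D2[OF p] transversal_summands_subset[OF p]
    by (auto elim!: set_plus_elim intro!: subspace_add[OF tr])
qed

text \<open>Difference of the Weingarten relations for \<open>J Y\<close> along \<open>X\<close> and
  for \<open>J X\<close> along \<open>Y\<close>; parallelism pulls \<open>J\<close> out of both
  derivatives, and torsion-freeness turns what is left inside into the bracket.\<close>

lemma J_lie_bracket_transversal:
  assumes p: "p \<in> points M"
    and X: "smooth_vf_on M (points M) X" and Y: "smooth_vf_on M (points M) Y"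
  defines "A \<equiv> shape_operator Mb nabla M f (transversal_bundle ltr STMperp)"
  shows "J (f p) (differential Mb M f p (lie_bracket M X Y p)) -
      differential Mb M f p (A (J_along Mb J M f X) Y p - A (J_along Mb J M f Y) X p)
    \<in> transversal_bundle ltr STMperp p"
proof -
  have cov: "cov_along Mb nabla M f Z (J_along Mb J M f W) p =
      J (f p) (cov_along Mb nabla M f Z (\<lambda>x. differential Mb M f x (W x)) p)"
    if "smooth_vf_on M (points M) W" for Z W
    using cov_along_J[OF p refl refl pushforward_differentiable[OF M.chart_at[OF p] chart_at[OF image_in_points[OF p]] that]]
    by (simp add: J_along_def[abs_def])
  have *: "cov_along Mb nabla M f X (J_along Mb J M f Y) p + differential Mb M f p (A (J_along Mb J M f Y) X p) -
      (cov_along Mb nabla M f Y (J_along Mb J M f X) p + differential Mb M f p (A (J_along Mb J M f X) Y p))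
      \<in> transversal_bundle ltr STMperp p"
    unfolding A_def by (intro subspace_diff[OF subspace_transversal_bundle[OF p]] shape_operator_transversal p)
  have J_diff: "J (f p) u + a - (J (f p) v + b) = J (f p) (u - v) - (b - a)" for u v a b
    by (simp add: linear_diff[OF linear_J[OF p]])
  with * show ?thesis
    by (simp only: J_diff cov[OF X] cov[OF Y] cov_along_torsion_free[OF p X Y]
        linear_diff[OF linear_differential[OF p]])
qed

theorem integrable_D_tilde_iff:
  defines "E \<equiv> D_tilde Mb J M f D2 L1 S"
    and "A \<equiv> shape_operator Mb nabla M f (transversal_bundle ltr STMperp)"
  shows "integrable_distribution M E \<longleftrightarrow>
    (\<forall>X\<in>distribution_sections M E. \<forall>Y\<in>distribution_sections M E.
      (\<lambda>p. A (J_along Mb J M f X) Y p - A (J_along Mb J M f Y) X p) \<in> distribution_sections M E)"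
  unfolding integrable_distribution_def
\<comment> \<open>The equivalence holds for each pair \<open>X\<close>, \<open>Y\<close> separately,
  so the quantifiers of both sides are matched.\<close>
proof (intro ball_cong refl)
  fix X Y assume XY: "X \<in> distribution_sections M E" "Y \<in> distribution_sections M E"
  then have X: "smooth_vf_on M (points M) X" and Y: "smooth_vf_on M (points M) Y"
    by (auto simp: distribution_sections_def)
  define W where "W p = A (J_along Mb J M f X) Y p - A (J_along Mb J M f Y) X p" for p
  have key: "J (f p) (differential Mb M f p (lie_bracket M X Y p)) - differential Mb M f p (W p)
      \<in> transversal_bundle ltr STMperp p" if "p \<in> points M" for p
    using J_lie_bracket_transversal[OF that X Y] by (simp add: W_def A_def)
  have W_zero: "W p = 0" if p: "p \<in> points M" and "lie_bracket M X Y p \<in> E p" for p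
  proof -
    have "J (f p) (differential Mb M f p (lie_bracket M X Y p)) \<in> transversal_bundle ltr STMperp p"
      using that(2) J_D_anti[OF p] by (auto simp: E_def D_tilde_def)
    from subspace_diff[OF subspace_transversal_bundle[OF p] this key[OF p]]
    have "differential Mb M f p (W p) \<in> transversal_bundle ltr STMperp p" by simp
    then have "differential Mb M f p (W p) = differential Mb M f p 0"
      using tangent_inter_transversal[OF p] linear_0[OF linear_differential[OF p]]
      unfolding tangent_bundle_def by auto
    then show ?thesis by (rule injD[OF immersion_inj[OF p]])
  qed
  have in_E: "lie_bracket M X Y p \<in> E p" if p: "p \<in> points M" and "W p \<in> E p" for p
  proof -
    note T = subspace_tangent_bundle[OF p] and tr = subspace_transversal_bundle[OF p]
    let ?L = "differential Mb M f p (lie_bracket M X Y p)"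
    let ?W = "differential Mb M f p (W p)"
    have "?L \<in> D_inv p + D_anti p"
      unfolding tangent_bundle_eq[OF p, symmetric] by (simp add: tangent_bundle_def)
    then obtain u v where u: "u \<in> D_inv p" and v: "v \<in> D_anti p" and L: "?L = u + v"
      by (rule set_plus_elim)
    have Ju: "J (f p) u \<in> D_inv p" using u J_D_inv[OF p] by blast
    have "J (f p) v \<in> transversal_bundle ltr STMperp p" using v J_D_anti[OF p] by blast
    from subspace_diff[OF tr key[OF p] this]
    have "J (f p) u - ?W \<in> transversal_bundle ltr STMperp p"
      by (simp add: L linear_add[OF linear_J[OF p]])
    moreover have "J (f p) u \<in> tangent_bundle Mb M f p"
      unfolding tangent_bundle_eq[OF p]
      using set_plus_intro[OF Ju subspace_0[OF subspace_D_anti[OF p]]] by simp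
    then have "J (f p) u - ?W \<in> tangent_bundle Mb M f p"
      by (intro subspace_diff[OF T]) (simp_all add: tangent_bundle_def)
    ultimately have "J (f p) u - ?W = 0"
      using tangent_inter_transversal[OF p] by blast
    then have "J (f p) u = ?W" by simp
    moreover have "?W \<in> D_anti p" using that(2) by (simp add: E_def D_tilde_def)
    ultimately have "J (f p) u = 0" using D_inv_inter_D_anti[OF p Ju] by simp
    then have "u = 0"
      using J_square[OF image_in_points[OF p], of u] linear_0[OF linear_J[OF p]] by simp
    then show ?thesis using L v by (simp add: E_def D_tilde_def)
  qed
  have "smooth_vf_on M (points M) (lie_bracket M X Y)"
    by (rule M.smooth_vf_on_lie_bracket[OF openin_topspace X Y])
  \<comment> \<open>Smoothness of \<open>W\<close> has to be shown only when the bracket lies in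
    \<open>E\<close>, and then \<open>W_zero\<close> makes \<open>W\<close> the zero field.\<close>
  moreover have "smooth_vf_on M (points M) W" if "\<And>p. p \<in> points M \<Longrightarrow> W p = 0"
    by (rule M.smooth_vf_on_cong[OF openin_topspace _ M.smooth_vf_on_zero[OF openin_topspace]])
      (simp add: that)
  moreover have "0 \<in> E p" if "p \<in> points M" for p
    using subspace_0[OF subspace_D_anti[OF that]] linear_0[OF linear_differential[OF that]]
    by (simp add: E_def D_tilde_def)
  ultimately have "lie_bracket M X Y \<in> distribution_sections M E \<longleftrightarrow> W \<in> distribution_sections M E"
    using W_zero in_E unfolding distribution_sections_def by auto
  then show "lie_bracket M X Y \<in> distribution_sections M E \<longleftrightarrow>
      (\<lambda>p. A (J_along Mb J M f X) Y p - A (J_along Mb J M f Y) X p) \<in> distribution_sections M E"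
    unfolding W_def .
qed

end

theorem theorem3p5:
  fixes Mb :: "('a, 'e::euclidean_space) manifold"
    and q :: nat
    and g :: "'a \<Rightarrow> 'e \<Rightarrow> 'e \<Rightarrow> real"
    and nabla :: "('a \<Rightarrow> 'e) \<Rightarrow> ('a \<Rightarrow> 'e) \<Rightarrow> 'a \<Rightarrow> 'e"
    and J :: "'a \<Rightarrow> 'e \<Rightarrow> 'e"
    and M :: "('b, 'd::euclidean_space) manifold"
    and f :: "'b \<Rightarrow> 'a"
    and r :: nat
    and STM STMperp ltr D1 D2 D0 D' L1 L2 S :: "'b \<Rightarrow> 'e set"
  defines "Dt \<equiv> D_tilde Mb J M f D2 L1 S"
    and "A \<equiv> shape_operator Mb nabla M f (transversal_bundle ltr STMperp)"
  assumes "STCR_lightlike_submanifold Mb q g nabla J M f r STM STMperp ltr D1 D2 D0 D' L1 L2 S"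
  shows "integrable_distribution M Dt \<longleftrightarrow>
    (\<forall>X\<in>distribution_sections M Dt. \<forall>Y\<in>distribution_sections M Dt.
      (\<lambda>p. A (J_along Mb J M f X) Y p - A (J_along Mb J M f Y) X p) \<in> distribution_sections M Dt)"
  using STCR_lightlike_submanifold.integrable_D_tilde_iff[OF assms(3)] unfolding Dt_def A_def .

end
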